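(* Let $p=p_n\in(0,1)$ and let $x=x_n$ be non-negative integers such that, as $n\to\infty$, $p\to0$, $np\to\infty$ and $|x-n\alpha|=o\big(\min(np,\,n^{2/3})\big)$. Then $$\frac{P(\tilde S=x)}{\mathrm{BI}(N,\tilde p)\{x\}}=1+o(1)\quad(n\to\infty).$$
   Context: $\eta_1,\dots,\eta_{n+1}$ are i.i.d. Bernoulli random variables with $P(\eta_1=1)=p=1-P(\eta_1=0)$, and $\tilde S=\sum_{j=1}^n\eta_j(1-\eta_{j+1})$. $\alpha=p(1-p)$. $\tilde N=\frac{n^2}{3n-2}$, $N=\lfloor\tilde N\rfloor$, $\tilde p=n\alpha/N$. $\mathrm{BI}(N,\tilde p)\{k\}=\binom Nk\tilde p^k(1-\tilde p)^{N-k}$ is the binomial distribution. *)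

theory Defs
  imports "HOL-Probability.Probability" "HOL-Library.Landau_Symbols"
begin

definition eta_pmf :: "nat \<Rightarrow> real \<Rightarrow> (nat \<Rightarrow> bool) pmf" where
  "eta_pmf n p = Pi_pmf {1..n+1} False (\<lambda>_. bernoulli_pmf p)"

definition Stil :: "nat \<Rightarrow> (nat \<Rightarrow> bool) \<Rightarrow> nat" where
  "Stil n \<eta> = (\<Sum>j=1..n. of_bool (\<eta> j) * (1 - of_bool (\<eta> (Suc j))))"

definition probS :: "nat \<Rightarrow> real \<Rightarrow> nat \<Rightarrow> real" where
  "probS n p x = measure_pmf.prob (eta_pmf n p) {\<eta>. Stil n \<eta> = x}"

definition alpha :: "real \<Rightarrow> real" where
  "alpha p = p * (1 - p)"

definition Ntil :: "nat \<Rightarrow> real" where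
  "Ntil n = (real n)^2 / (3 * real n - 2)"

definition NN :: "nat \<Rightarrow> nat" where
  "NN n = nat \<lfloor>Ntil n\<rfloor>"

definition ptil :: "nat \<Rightarrow> real \<Rightarrow> real" where
  "ptil n p = real n * alpha p / real (NN n)"

definition BI :: "nat \<Rightarrow> real \<Rightarrow> nat \<Rightarrow> real" where
  "BI N q k = real (N choose k) * q ^ k * (1 - q) ^ (N - k)"

end

theory Submission
  imports Defs
begin

text \<open>By a Fibonacci-type recurrence in \<open>n\<close>, the generating function \<open>E z\<^bsup>S\<^esup>\<close> is a polynomial in
  \<open>\<alpha> (z - 1)\<close> all of whose roots are real and explicit (those of a Chebyshev polynomial), so \<open>S\<close> is
  distributed as a sum of independent Bernoulli variables with success probabilities
  \<open>r\<^sub>k = 4 \<alpha> cos\<^sup>2 (\<pi> (k + 1) / (n + 2))\<close>, \<open>k < \<lfloor>(n + 1) / 2\<rfloor>\<close>. Its linear and quadratic coefficients give \<open>\<Sum> r\<^sub>k = n \<alpha>\<close> and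
  \<open>\<Sum> r\<^sub>k\<^sup>2 = (3 n - 2) \<alpha>\<^sup>2\<close>, and the binomial distribution with parameters \<open>N\<close> and \<open>n \<alpha> / N\<close> matches both,
  up to the rounding of \<open>N\<close>.
  Tilt both distributions by the factor \<open>(1 + w)\<^bsup>k\<^esup>\<close> for which the tilted binomial distribution has mean
  \<open>x\<close>. The ratio at \<open>x\<close> becomes the ratio of the generating functions at \<open>1 + w\<close>, which tends to 1
  because their logarithms agree to second order in \<open>w\<close> and \<open>n\<^bsup>1/3\<^esup> \<alpha> w \<rightarrow> 0\<close>, times a ratio of tilted
  probabilities near their means, which tends to 1 by a local limit theorem for sums of independent
  Bernoulli variables.\<close>

section \<open>Local limit theorem for sums of independent Bernoulli variables\<close>

text \<open>With \<open>y = \<bar>u\<bar> / 4\<close> one has 1 - cos u = 8 sin^2 y cos^2 y, and on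
  [0, pi/4] both sin y >= y/2 and cos^2 y >= 1/2 hold. The constant 1/16 is not sharp; what matters
  is a positive quadratic lower bound on all of [-pi, pi].\<close>

lemma one_minus_cos_ge:
  fixes u :: real
  assumes "\<bar>u\<bar> \<le> pi"
  shows "u\<^sup>2 / 16 \<le> 1 - cos u"
proof -
  define y where "y = \<bar>u\<bar> / 4"
  have y: "0 \<le> y" "y \<le> pi / 4"
    using assms by (auto simp: y_def)
  have half: "1 / 2 \<le> (cos t)\<^sup>2" if "0 \<le> t" "t \<le> pi / 4" for t :: real
  proof -
    have "0 \<le> cos (2 * t)"
      using that by (intro cos_ge_zero) auto
    then show ?thesis
      by (simp add: cos_double_cos)
  qed
  have cos_half: "1 / 2 \<le> cos t" if "0 \<le> t" "t \<le> pi / 4" for t :: real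
  proof -
    have "0 \<le> cos t"
      using that by (intro cos_ge_zero) auto
    moreover have "(1 / 2)\<^sup>2 \<le> (cos t)\<^sup>2"
      using half[OF that] by (simp add: power2_eq_square)
    ultimately show ?thesis
      by (rule power2_le_imp_le[rotated])
  qed
  have "sin 0 - 0 / 2 \<le> sin y - y / 2"
  proof (rule DERIV_nonneg_imp_nondecreasing[OF y(1)])
    fix t assume "0 \<le> t" "t \<le> y"
    then have "((\<lambda>t. sin t - t / 2) has_real_derivative cos t - 1 / 2) (at t)" "0 \<le> cos t - 1 / 2"
      using cos_half[of t] y by (auto intro!: derivative_eq_intros)
    then show "\<exists>d. ((\<lambda>t. sin t - t / 2) has_real_derivative d) (at t) \<and> 0 \<le> d"
      by blast
  qed
  then have "(y / 2)\<^sup>2 \<le> (sin y)\<^sup>2"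
    using y by (intro power_mono) auto
  then have "(y / 2)\<^sup>2 * (1 / 2) \<le> (sin y)\<^sup>2 * (cos y)\<^sup>2"
    using half[OF y] by (intro mult_mono) auto
  also have "\<dots> = (sin (2 * y))\<^sup>2 / 4"
    by (simp add: sin_double power_mult_distrib)
  also have "\<dots> = (1 - cos (2 * (2 * y))) / 8"
    by (subst cos_double_sin) simp
  also have "cos (2 * (2 * y)) = cos u"
    by (simp add: y_def)
  finally show ?thesis
    by (simp add: y_def power2_eq_square)
qed

text \<open>The squared modulus equals 1 - 2 r (1 - r) (1 - cos u), and 1 - t <= exp (-t). The bound
  is uniform on the whole period, so the product over all factors is dominated by a Gaussian in
  u.\<close>

lemma norm_bernoulli_char_le:
  fixes r u :: real
  assumes "0 \<le> r" "r \<le> 1" "\<bar>u\<bar> \<le> pi"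
  shows "norm ((1 - of_real r) + of_real r * cis u) \<le> exp (- (r * (1 - r) * u\<^sup>2 / 16))"
proof -
  have "(norm ((1 - of_real r) + of_real r * cis u))\<^sup>2 = (1 - r + r * cos u)\<^sup>2 + (r * sin u)\<^sup>2"
    by (simp add: cmod_power2)
  also have "\<dots> = (1 - r)\<^sup>2 + 2 * (1 - r) * r * cos u + r\<^sup>2 * ((sin u)\<^sup>2 + (cos u)\<^sup>2)"
    by algebra
  also have "\<dots> = 1 - 2 * (r * (1 - r)) * (1 - cos u)"
    unfolding sin_cos_squared_add by (simp add: power2_eq_square algebra_simps)
  also have "\<dots> \<le> 1 - 2 * (r * (1 - r)) * (u\<^sup>2 / 16)"
    using one_minus_cos_ge[OF assms(3)] assms by (intro diff_left_mono mult_left_mono) auto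
  also have "\<dots> \<le> exp (- (2 * (r * (1 - r)) * (u\<^sup>2 / 16)))"
    using exp_ge_add_one_self[of "- (2 * (r * (1 - r)) * (u\<^sup>2 / 16))"] by simp
  also have "\<dots> = (exp (- (r * (1 - r) * u\<^sup>2 / 16)))\<^sup>2"
    by (simp add: power2_eq_square mult_exp_exp)
  finally show ?thesis
    by (rule power2_le_imp_le) simp
qed

lemma norm_cis_taylor2_le:
  "norm (cis x - (1 + \<i> * of_real x - of_real (x\<^sup>2 / 2))) \<le> \<bar>x\<bar> ^ 3 / 6"
proof -
  have "(\<Sum>k\<le>2. (\<i> * complex_of_real x) ^ k / fact k) = 1 + \<i> * of_real x - of_real (x\<^sup>2 / 2)"
    by (simp add: eval_nat_numeral algebra_simps)
  then show ?thesis
    using iexp_approx1[of x 2] by (simp add: cis_conv_exp eval_nat_numeral)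
qed

lemma abs_exp_minus_taylor1_le:
  fixes y :: real
  assumes "0 \<le> y"
  shows "\<bar>exp (- y) - (1 - y)\<bar> \<le> y\<^sup>2 / 2"
proof -
  have "1 - y \<le> exp (- y)"
    using exp_ge_add_one_self[of "- y"] by simp
  \<comment> \<open>The difference exp (-t) - (1 - t + t^2/2) vanishes at 0 and has derivative 1 - t
    - exp (-t) <= 0.\<close>
  moreover have "0 - (1 - 0 + 0\<^sup>2 / 2) + exp (- 0) \<ge> 0 - (1 - y + y\<^sup>2 / 2) + exp (- y)"
  proof (rule DERIV_nonpos_imp_nonincreasing[OF assms])
    fix t :: real assume "0 \<le> t"
    have "((\<lambda>t. 0 - (1 - t + t\<^sup>2 / 2) + exp (- t)) has_real_derivative 1 - t - exp (- t)) (at t)"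
      by (auto intro!: derivative_eq_intros)
    moreover have "1 - t - exp (- t) \<le> 0"
      using exp_ge_add_one_self[of "- t"] by simp
    ultimately show "\<exists>d. ((\<lambda>t. 0 - (1 - t + t\<^sup>2 / 2) + exp (- t)) has_real_derivative d) (at t) \<and> d \<le> 0"
      by blast
  qed
  ultimately show ?thesis
    by simp
qed

text \<open>After centring, the characteristic function is the average of \<open>cis\<close> at -r u
  and (1 - r) u with weights 1 - r and r, and each term is expanded to second order. Since r^2 + (1
  - r)^2 <= 1 and r (1 - r) <= 1, the error keeps a factor r (1 - r); summed over many variables it
  is therefore proportional to the total variance.\<close>

lemma bernoulli_char_gaussian_approx:
  fixes r u :: real
  assumes "0 \<le> r" "r \<le> 1"
  shows "norm (((1 - of_real r) + of_real r * cis u) * cis (- (r * u))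
           - of_real (exp (- (r * (1 - r) * u\<^sup>2 / 2))))
         \<le> r * (1 - r) * (\<bar>u\<bar> ^ 3 / 6 + u ^ 4 / 8)"
proof -
  let ?T = "\<lambda>x. 1 + \<i> * complex_of_real x - of_real (x\<^sup>2 / 2)"
  define y where "y = r * (1 - r) * u\<^sup>2 / 2"
  have y0: "0 \<le> y"
    using assms by (simp add: y_def)
  have cisu: "cis u * cis (- (r * u)) = cis ((1 - r) * u)"
    by (simp add: cis_mult algebra_simps)
  \<comment> \<open>The mean is zero, so the linear terms cancel, and the quadratic terms add up to
    the variance times u^2/2, which is \<open>y\<close>.\<close>
  have main: "(1 - of_real r) * ?T (- (r * u)) + of_real r * ?T ((1 - r) * u) = of_real (1 - y)"
    by (simp add: y_def complex_eq_iff field_simps power2_eq_square)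
  have split: "((1 - of_real r) + of_real r * cis u) * cis (- (r * u)) - of_real (exp (- y))
     = of_real (1 - r) * (cis (- (r * u)) - ?T (- (r * u)))
     + of_real r * (cis ((1 - r) * u) - ?T ((1 - r) * u)) + of_real (1 - y - exp (- y))"
    using main unfolding cisu[symmetric] by (simp add: algebra_simps)
  have "norm (of_real (1 - r) * (cis (- (r * u)) - ?T (- (r * u)))) \<le> (1 - r) * (\<bar>r * u\<bar> ^ 3 / 6)"
    unfolding norm_mult using assms norm_cis_taylor2_le[of "- (r * u)"]
    by (intro mult_mono) (auto simp del: of_real_diff)
  moreover have "norm (of_real r * (cis ((1 - r) * u) - ?T ((1 - r) * u))) \<le> r * (\<bar>(1 - r) * u\<bar> ^ 3 / 6)"
    unfolding norm_mult using assms norm_cis_taylor2_le[of "(1 - r) * u"]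
    by (intro mult_mono) (auto simp del: of_real_diff)
  moreover have "norm (complex_of_real (1 - y - exp (- y))) \<le> y\<^sup>2 / 2"
    unfolding norm_of_real using abs_exp_minus_taylor1_le[OF y0] by (simp add: abs_minus_commute)
  ultimately have "norm (((1 - of_real r) + of_real r * cis u) * cis (- (r * u)) - of_real (exp (- y)))
    \<le> (1 - r) * (\<bar>r * u\<bar> ^ 3 / 6) + r * (\<bar>(1 - r) * u\<bar> ^ 3 / 6) + y\<^sup>2 / 2"
    unfolding split by (intro order_trans[OF norm_triangle_ineq] add_mono)
  also have "\<dots> \<le> r * (1 - r) * (\<bar>u\<bar> ^ 3 / 6) + r * (1 - r) * (u ^ 4 / 8)"
  proof (rule add_mono)
    have abs_u: "\<bar>r * u\<bar> = r * \<bar>u\<bar>" "\<bar>(1 - r) * u\<bar> = (1 - r) * \<bar>u\<bar>"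
      using assms by (simp_all add: abs_mult)
    have "(1 - r) * (\<bar>r * u\<bar> ^ 3 / 6) + r * (\<bar>(1 - r) * u\<bar> ^ 3 / 6)
        = (r * (1 - r) * (\<bar>u\<bar> ^ 3 / 6)) * (r\<^sup>2 + (1 - r)\<^sup>2)"
      unfolding abs_u by (simp add: field_simps eval_nat_numeral)
    also have "\<dots> \<le> (r * (1 - r) * (\<bar>u\<bar> ^ 3 / 6)) * 1"
    proof (rule mult_left_mono)
      have "r\<^sup>2 + (1 - r)\<^sup>2 = 1 - 2 * (r * (1 - r))"
        by (simp add: power2_eq_square algebra_simps)
      then show "r\<^sup>2 + (1 - r)\<^sup>2 \<le> 1"
        using assms by simp
    qed (use assms in auto)
    finally show "(1 - r) * (\<bar>r * u\<bar> ^ 3 / 6) + r * (\<bar>(1 - r) * u\<bar> ^ 3 / 6)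
        \<le> r * (1 - r) * (\<bar>u\<bar> ^ 3 / 6)" by simp
    have "y\<^sup>2 / 2 = (r * (1 - r) * (u ^ 4 / 8)) * (r * (1 - r))"
      by (simp add: y_def power2_eq_square eval_nat_numeral)
    also have "\<dots> \<le> (r * (1 - r) * (u ^ 4 / 8)) * 1"
      using assms by (intro mult_left_mono mult_le_one) auto
    finally show "y\<^sup>2 / 2 \<le> r * (1 - r) * (u ^ 4 / 8)" by simp
  qed
  finally show ?thesis
    by (simp add: y_def algebra_simps)
qed

section \<open>Fourier inversion and the local limit theorem\<close>

lemma integral_cis_int:
  "(\<integral>\<theta>. indicator {- pi..pi} \<theta> *\<^sub>R cis (of_int k * \<theta>) \<partial>lborel) = (if k = 0 then 2 * pi else 0)"
proof (cases "k = 0")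
  case True
  then show ?thesis
    by (simp add: scaleR_conv_of_real)
next
  case False
  define F where "F = (\<lambda>\<theta>. cis (of_int k * \<theta>) / (\<i> * of_int k))"
  have "(\<integral>\<theta>. indicator {- pi..pi} \<theta> *\<^sub>R cis (of_int k * \<theta>) \<partial>lborel) = F pi - F (- pi)"
  proof (rule integral_FTC_atLeastAtMost)
    fix \<theta> :: real
    have "((\<lambda>z. exp (\<i> * (of_int k * z)) / (\<i> * of_int k)) has_field_derivative
        exp (\<i> * (of_int k * of_real \<theta>))) (at (of_real \<theta>))"
      using False by (auto intro!: derivative_eq_intros simp: field_simps)
    from has_vector_derivative_real_field[OF this]
    show "(F has_vector_derivative cis (of_int k * \<theta>)) (at \<theta> within {- pi..pi})"
      unfolding F_def cis_conv_exp by simp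
  qed (auto intro!: continuous_intros)
  also have "F pi = F (- pi)"
    by (simp add: F_def cis_conv_exp complex_eq_iff Re_divide Im_divide Re_exp Im_exp sin_times_pi_eq_0)
  finally show ?thesis
    using False by simp
qed

text \<open>Orthogonality of the functions \<open>cis (k * \<theta>)\<close> on [-pi, pi] isolates
  one coefficient of the polynomial.\<close>

lemma poly_coeff_fourier:
  fixes P :: "complex poly"
  shows "(\<integral>\<theta>. indicator {- pi..pi} \<theta> *\<^sub>R (poly P (cis \<theta>) * cis (- (real x * \<theta>))) \<partial>lborel)
         = 2 * pi * coeff P x"
proof -
  have int: "integrable lborel (\<lambda>\<theta>. indicator {- pi..pi} \<theta> *\<^sub>R cis (of_int k * \<theta>))" for k :: int
    by (intro borel_integrable_atLeastAtMost' continuous_intros borel_integrable_compact) auto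
  have "indicator {- pi..pi} \<theta> *\<^sub>R (poly P (cis \<theta>) * cis (- (real x * \<theta>)))
     = (\<Sum>i\<le>degree P. coeff P i * (indicator {- pi..pi} \<theta> *\<^sub>R cis (of_int (int i - int x) * \<theta>)))" for \<theta>
  proof -
    have "real i * \<theta> + - (real x * \<theta>) = of_int (int i - int x) * \<theta>" for i
      by (simp add: algebra_simps)
    then have "cis \<theta> ^ i * cis (- (real x * \<theta>)) = cis (of_int (int i - int x) * \<theta>)" for i
      unfolding Complex.DeMoivre cis_mult by (simp only:)
    then show ?thesis
      by (simp add: poly_altdef sum_distrib_right scaleR_sum_right mult.assoc)
  qed
  then have "(\<integral>\<theta>. indicator {- pi..pi} \<theta> *\<^sub>R (poly P (cis \<theta>) * cis (- (real x * \<theta>))) \<partial>lborel)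
     = (\<Sum>i\<le>degree P. coeff P i * (\<integral>\<theta>. indicator {- pi..pi} \<theta> *\<^sub>R cis (of_int (int i - int x) * \<theta>) \<partial>lborel))"
    using int by (simp only: Bochner_Integration.integral_sum integrable_mult_right integral_mult_right_zero)
  also have "\<dots> = (\<Sum>i\<le>degree P. if i = x then 2 * pi * coeff P x else 0)"
    by (intro sum.cong refl) (simp only: integral_cis_int, auto)
  also have "\<dots> = 2 * pi * coeff P x"
    by (auto simp: coeff_eq_0)
  finally show ?thesis .
qed

lemma coeff_of_real_bernoulli_poly:
  "coeff (\<Prod>k<d. [:1 - of_real (r k), of_real (r k) :: complex:]) x
     = of_real (coeff (\<Prod>k<(d::nat). [:1 - r k, r k:]) x)"
proof (induction d arbitrary: x)
  case 0
  then show ?case by (cases x) auto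
next
  case (Suc d)
  then show ?case
    by (cases x) (simp_all add: mult.commute[of "prod _ _"] coeff_pCons)
qed

lemma prod_cis: "finite A \<Longrightarrow> (\<Prod>k\<in>A. cis (f k)) = cis (sum f A)"
  by (induction rule: finite_induct) (simp_all add: cis_mult)

text \<open>The Fourier integral for the coefficient is rescaled by t = u * sqrt v. Its integrand is
  dominated by exp (-t^2/16) and converges pointwise to exp (-t^2/2), whose integral is sqrt (2 pi).
  The success probabilities may change with n; the hypotheses ask for variance tending to infinity
  and \<open>x\<close> within o(sqrt v) of the mean.\<close>

lemma bernoulli_poly_llt:
  fixes r :: "nat \<Rightarrow> nat \<Rightarrow> real" and d x :: "nat \<Rightarrow> nat"
  defines "v \<equiv> \<lambda>n. \<Sum>k<d n. r n k * (1 - r n k)"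
  assumes r: "eventually (\<lambda>n. \<forall>k<d n. 0 \<le> r n k \<and> r n k \<le> 1) sequentially"
    and v: "filterlim v at_top sequentially"
    and x: "(\<lambda>n. (real (x n) - (\<Sum>k<d n. r n k)) / sqrt (v n)) \<longlonglongrightarrow> 0"
  shows "(\<lambda>n. sqrt (v n) * coeff (\<Prod>k<d n. [:1 - r n k, r n k:]) (x n)) \<longlonglongrightarrow> 1 / sqrt (2 * pi)"
proof -
  define \<phi> where "\<phi> = (\<lambda>n u. \<Prod>k<d n. (1 - of_real (r n k)) + of_real (r n k) * cis u)"
  define good where "good = (\<lambda>n. v n > 0 \<and> (\<forall>k<d n. 0 \<le> r n k \<and> r n k \<le> 1))"
  \<comment> \<open>Setting \<open>h n\<close> to 0 when \<open>good n\<close> fails makes the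
    domination hold for every n, as dominated convergence requires, although the hypotheses hold
    only eventually.\<close>
  define h where "h = (\<lambda>n t. if good n then indicator {- pi..pi} (t / sqrt (v n)) *\<^sub>R
      (\<phi> n (t / sqrt (v n)) * cis (- (real (x n) * (t / sqrt (v n))))) else 0)"
  have ev: "eventually good sequentially"
    unfolding good_def using v r by (auto simp: filterlim_at_top_dense intro: eventually_conj)
  have s: "filterlim (\<lambda>n. sqrt (v n)) at_top sequentially"
    using filterlim_compose[OF sqrt_at_top v] .
  have coeff_eq: "sqrt (v n) * coeff (\<Prod>k<d n. [:1 - r n k, r n k:]) (x n)
      = Re ((\<integral>t. h n t \<partial>lborel) / (2 * pi))" if good: "good n" for n
  proof -
    have "v n > 0"
      using good by (simp add: good_def)
    let ?P = "\<Prod>k<d n. [:1 - of_real (r n k), of_real (r n k) :: complex:]"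
    have "poly ?P (cis u) = \<phi> n u" for u
      by (simp add: poly_prod \<phi>_def mult.commute)
    then have "2 * pi * complex_of_real (coeff (\<Prod>k<d n. [:1 - r n k, r n k:]) (x n))
       = (\<integral>\<theta>. indicator {- pi..pi} \<theta> *\<^sub>R (\<phi> n \<theta> * cis (- (real (x n) * \<theta>))) \<partial>lborel)"
      using poly_coeff_fourier[of ?P "x n"] by (simp add: coeff_of_real_bernoulli_poly)
    also have "\<dots> = \<bar>1 / sqrt (v n)\<bar> *\<^sub>R (\<integral>t. h n t \<partial>lborel)"
      using good \<open>v n > 0\<close> by (subst lborel_integral_real_affine[of "1 / sqrt (v n)" _ 0]) (auto simp: h_def)
    finally have "complex_of_real (sqrt (v n) * coeff (\<Prod>k<d n. [:1 - r n k, r n k:]) (x n))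
       = (\<integral>t. h n t \<partial>lborel) / (2 * pi)"
      using \<open>v n > 0\<close> by (simp add: scaleR_conv_of_real field_simps)
    then show ?thesis
      by (metis Re_complex_of_real)
  qed
  have lim: "(\<lambda>n. \<integral>t. h n t \<partial>lborel) \<longlonglongrightarrow> (\<integral>t. complex_of_real (exp (- (t\<^sup>2 / 2))) \<partial>lborel)"
  proof (rule integral_dominated_convergence)
    \<comment> \<open>Integrability of the dominating function: it is a multiple of the normal
      density with variance 8.\<close>
    have "(\<lambda>t::real. exp (- (t\<^sup>2 / 16))) = (\<lambda>t. sqrt (16 * pi) * normal_density 0 (sqrt 8) t)"
      by (simp add: normal_density_def fun_eq_iff)
    then show "integrable lborel (\<lambda>t::real. exp (- (t\<^sup>2 / 16)))"
      by simp
    have [measurable]: "cis \<in> borel_measurable borel"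
      by (intro borel_measurable_continuous_onI continuous_intros)
    show "h n \<in> borel_measurable lborel" for n
      unfolding h_def \<phi>_def by measurable
    show "(\<lambda>t. complex_of_real (exp (- (t\<^sup>2 / 2)))) \<in> borel_measurable lborel"
      by measurable
    have "norm (h n t) \<le> exp (- (t\<^sup>2 / 16))" for n t
    proof (cases "good n \<and> \<bar>t / sqrt (v n)\<bar> \<le> pi")
      case False
      then have "good n \<Longrightarrow> t / sqrt (v n) \<notin> {- pi..pi}"
        by (auto simp only: abs_le_iff atLeastAtMost_iff minus_le_iff)
      then have "h n t = 0"
        by (simp add: h_def)
      then show ?thesis by simp
    next
      case True
      then have vn: "v n > 0" and rn: "\<And>k. k < d n \<Longrightarrow> 0 \<le> r n k \<and> r n k \<le> 1"
        by (simp_all add: good_def)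
      define u where "u = t / sqrt (v n)"
      have "u \<in> {- pi..pi}"
        using True unfolding u_def by (auto simp only: abs_le_iff atLeastAtMost_iff minus_le_iff)
      then have "norm (h n t) = norm (\<phi> n u)"
        using True by (simp add: h_def norm_mult flip: u_def)
      also have "\<dots> \<le> (\<Prod>k<d n. exp (- (r n k * (1 - r n k) * u\<^sup>2 / 16)))"
        unfolding \<phi>_def prod_norm[symmetric] using rn True
        by (intro prod_mono conjI norm_ge_zero norm_bernoulli_char_le) (auto simp: u_def)
      also have "\<dots> = exp (- (v n * u\<^sup>2 / 16))"
        by (simp add: exp_sum[symmetric] v_def sum_distrib_right sum_negf sum_divide_distrib)
      also have "v n * u\<^sup>2 = t\<^sup>2"
        using vn by (simp add: u_def power_divide)
      finally show ?thesis .
    qed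
    then show "AE t in lborel. norm (h n t) \<le> exp (- (t\<^sup>2 / 16))" for n
      by simp
    have "(\<lambda>n. h n t) \<longlonglongrightarrow> complex_of_real (exp (- (t\<^sup>2 / 2)))" for t
    proof -
      define u where "u = (\<lambda>n. t / sqrt (v n))"
      define \<psi> where "\<psi> = (\<lambda>n. \<Prod>k<d n. ((1 - of_real (r n k)) + of_real (r n k) * cis (u n)) * cis (- (r n k * u n)))"
      define \<delta> where "\<delta> = (\<lambda>n. (real (x n) - (\<Sum>k<d n. r n k)) / sqrt (v n))"
      have "u \<longlonglongrightarrow> 0"
        unfolding u_def by (intro real_tendsto_divide_at_top[OF tendsto_const s])
      then have "eventually (\<lambda>n. \<bar>u n\<bar> < pi) sequentially"
        using order_tendstoD(2)[OF tendsto_rabs_zero, of u sequentially pi] by simp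
      with ev have ev2: "eventually (\<lambda>n. good n \<and> \<bar>u n\<bar> \<le> pi) sequentially"
        by eventually_elim auto
      \<comment> \<open>Each factor is centred at its own mean. The phase left over measures the
        distance from \<open>x n\<close> to the total mean in units of the standard deviation, and
        tends to 1.\<close>
      have h_eq: "h n t = \<psi> n * cis (- (\<delta> n * t))" if n: "good n \<and> \<bar>u n\<bar> \<le> pi" for n
      proof -
        have vn: "v n > 0"
          using n by (simp add: good_def)
        have "\<psi> n = \<phi> n (u n) * cis (- ((\<Sum>k<d n. r n k) * u n))"
          by (simp add: \<psi>_def \<phi>_def prod.distrib prod_cis sum_distrib_right sum_negf)
        then have "\<psi> n * cis (- (\<delta> n * t)) = \<phi> n (u n) * cis (- ((\<Sum>k<d n. r n k) * u n) - \<delta> n * t)"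
          by (simp add: mult.assoc cis_mult)
        also have "- ((\<Sum>k<d n. r n k) * u n) - \<delta> n * t = - (real (x n) * u n)"
          using vn by (simp add: \<delta>_def u_def field_simps)
        finally have "\<psi> n * cis (- (\<delta> n * t)) = \<phi> n (u n) * cis (- (real (x n) * u n))" .
        moreover have "u n \<in> {- pi..pi}"
          using n by auto
        ultimately show ?thesis
          using n by (simp add: h_def u_def)
      qed
      have \<psi>_near: "norm (\<psi> n - of_real (exp (- (t\<^sup>2 / 2)))) \<le> \<bar>t\<bar> ^ 3 / 6 / sqrt (v n) + t ^ 4 / 8 / v n"
        if n: "good n \<and> \<bar>u n\<bar> \<le> pi" for n
      proof -
        have vn: "v n > 0"
          using n by (simp add: good_def)
        let ?a = "\<lambda>k. ((1 - of_real (r n k)) + of_real (r n k) * cis (u n)) * cis (- (r n k * u n))"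
        let ?b = "\<lambda>k. complex_of_real (exp (- (r n k * (1 - r n k) * (u n)\<^sup>2 / 2)))"
        have vu: "v n * (u n)\<^sup>2 = t\<^sup>2"
          using vn by (simp add: u_def power_divide)
        have "(\<Prod>k<d n. ?b k) = of_real (exp (- (v n * (u n)\<^sup>2 / 2)))"
          by (simp add: exp_sum[symmetric] v_def sum_distrib_right sum_negf sum_divide_distrib
                 flip: of_real_prod)
        then have "norm (\<psi> n - of_real (exp (- (t\<^sup>2 / 2)))) = norm ((\<Prod>k<d n. ?a k) - (\<Prod>k<d n. ?b k))"
          by (simp add: \<psi>_def vu)
        \<comment> \<open>Two products of numbers of modulus at most 1 differ by at most the sum of
          the differences of their factors.\<close>
        also have "\<dots> \<le> (\<Sum>k<d n. norm (?a k - ?b k))"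
        proof (rule norm_prod_diff)
          fix k assume "k \<in> {..<d n}"
          then have rk: "0 \<le> r n k" "r n k \<le> 1"
            using n by (auto simp: good_def)
          have "norm (?a k) \<le> exp (- (r n k * (1 - r n k) * (u n)\<^sup>2 / 16))"
            using norm_bernoulli_char_le[OF rk, of "u n"] n by (simp add: norm_mult)
          also have "\<dots> \<le> 1"
            using rk by simp
          finally show "norm (?a k) \<le> 1" .
          show "norm (?b k) \<le> 1"
            using rk by simp
        qed
        also have "\<dots> \<le> (\<Sum>k<d n. r n k * (1 - r n k) * (\<bar>u n\<bar> ^ 3 / 6 + u n ^ 4 / 8))"
          using n by (intro sum_mono bernoulli_char_gaussian_approx) (auto simp: good_def)
        also have "\<dots> = v n * (\<bar>u n\<bar> ^ 3 / 6 + u n ^ 4 / 8)"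
          by (simp add: v_def sum_distrib_right)
        \<comment> \<open>Splitting off v u^2 = t^2, which is fixed, leaves only positive powers of
          u, and u tends to 0.\<close>
        also have "\<dots> = (v n * (u n)\<^sup>2) * (\<bar>u n\<bar> / 6 + (u n)\<^sup>2 / 8)"
          by (simp add: eval_nat_numeral algebra_simps)
        also have "\<dots> = \<bar>t\<bar> ^ 3 / 6 / sqrt (v n) + t ^ 4 / 8 / v n"
          using vn unfolding vu by (simp add: u_def power_divide eval_nat_numeral field_simps)
        finally show ?thesis .
      qed
      have "\<psi> \<longlonglongrightarrow> of_real (exp (- (t\<^sup>2 / 2)))"
      proof (rule Lim_transform2)
        show "((\<lambda>n. of_real (exp (- (t\<^sup>2 / 2)))) \<longlongrightarrow> complex_of_real (exp (- (t\<^sup>2 / 2)))) sequentially"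
          by simp
        have "(\<lambda>n. \<bar>t\<bar> ^ 3 / 6 / sqrt (v n) + t ^ 4 / 8 / v n) \<longlonglongrightarrow> 0 + 0"
          by (intro tendsto_add real_tendsto_divide_at_top[OF tendsto_const] s v)
        then have bound0: "(\<lambda>n. \<bar>t\<bar> ^ 3 / 6 / sqrt (v n) + t ^ 4 / 8 / v n) \<longlonglongrightarrow> 0"
          by simp
        have "eventually (\<lambda>n. norm (of_real (exp (- (t\<^sup>2 / 2))) - \<psi> n) \<le> \<bar>t\<bar> ^ 3 / 6 / sqrt (v n) + t ^ 4 / 8 / v n) sequentially"
          using ev2 by eventually_elim (simp only: norm_minus_commute[of "of_real _"] \<psi>_near)
        from Lim_null_comparison[OF this bound0]
        show "(\<lambda>n. of_real (exp (- (t\<^sup>2 / 2))) - \<psi> n) \<longlonglongrightarrow> 0" .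
      qed
      moreover have "(\<lambda>n. cis (- (\<delta> n * t))) \<longlonglongrightarrow> cis (- (0 * t))"
        using x unfolding \<delta>_def by (intro tendsto_intros)
      ultimately have "(\<lambda>n. \<psi> n * cis (- (\<delta> n * t))) \<longlonglongrightarrow> of_real (exp (- (t\<^sup>2 / 2)))"
        using tendsto_mult by fastforce
      then show ?thesis
        by (rule Lim_transform_eventually) (use ev2 in \<open>eventually_elim, simp add: h_eq\<close>)
    qed
    then show "AE t in lborel. (\<lambda>n. h n t) \<longlonglongrightarrow> complex_of_real (exp (- (t\<^sup>2 / 2)))"
      by simp
  qed
  have "(\<lambda>t::real. exp (- (t\<^sup>2 / 2))) = (\<lambda>t. sqrt (2 * pi) * std_normal_density t)"
    by (simp add: std_normal_density_def fun_eq_iff)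
  then have "(\<integral>t. complex_of_real (exp (- (t\<^sup>2 / 2))) \<partial>lborel) = sqrt (2 * pi)"
    by (simp only: integral_complex_of_real) simp
  with lim have "(\<lambda>n. Re ((\<integral>t. h n t \<partial>lborel) / (2 * pi))) \<longlonglongrightarrow> Re (complex_of_real (sqrt (2 * pi)) / (2 * pi))"
    by (intro tendsto_intros) auto
  also have "Re (complex_of_real (sqrt (2 * pi)) / (2 * pi)) = 1 / sqrt (2 * pi)"
    by (simp add: real_sqrt_mult field_simps)
  finally show ?thesis
    by (rule Lim_transform_eventually) (use ev in \<open>eventually_elim, simp add: coeff_eq\<close>)
qed


text \<open>Replacing the variable X by z X multiplies the x-th coefficient by z^x. Dividing each
  linear factor by its value at X = 1, which is 1 + r (z - 1), makes it a Bernoulli generating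
  polynomial again.\<close>

lemma coeff_bernoulli_poly_tilt:
  assumes "z \<noteq> 0" and "\<And>k. k < d \<Longrightarrow> 1 + r k * (z - 1) \<noteq> 0"
  shows "coeff (\<Prod>k<(d::nat). [:1 - r k, r k :: real:]) x * z ^ x =
     (\<Prod>k<d. 1 + r k * (z - 1)) *
     coeff (\<Prod>k<d. [:1 - r k * z / (1 + r k * (z - 1)), r k * z / (1 + r k * (z - 1)):]) x"
proof -
  let ?g = "\<lambda>k. 1 + r k * (z - 1)"
  have "coeff (\<Prod>k<d. [:1 - r k, r k:]) x * z ^ x = coeff (pcompose (\<Prod>k<d. [:1 - r k, r k:]) [:0, z:]) x"
    by (simp add: coeff_pcompose_linear)
  also have "pcompose (\<Prod>k<d. [:1 - r k, r k:]) [:0, z:] = (\<Prod>k<d. [:1 - r k, r k * z:])"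
    by (simp add: pcompose_prod pcompose_pCons mult.commute)
  also have "\<dots> = (\<Prod>k<d. smult (?g k) [:1 - r k * z / ?g k, r k * z / ?g k:])"
    using assms(2) by (intro prod.cong refl) (auto simp: field_simps)
  also have "\<dots> = smult (\<Prod>k<d. ?g k) (\<Prod>k<d. [:1 - r k * z / ?g k, r k * z / ?g k:])"
    by (rule prod_smult)
  finally show ?thesis by simp
qed

section \<open>The generating function and its roots\<close>

text \<open>These are the Jacobsthal polynomials, with coefficients \<open>m - i choose i\<close>.
  The variable will stand for alpha (z - 1) and the index for n + 1.\<close>

fun fib_poly :: "nat \<Rightarrow> real poly" where
  "fib_poly 0 = 1"
| "fib_poly (Suc 0) = 1"
| "fib_poly (Suc (Suc m)) = fib_poly (Suc m) + [:0, 1:] * fib_poly m"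

lemma degree_fib_poly: "degree (fib_poly m) \<le> m div 2"
proof (induction m rule: fib_poly.induct)
  case (3 m)
  have "degree ([:0, 1:] * fib_poly m) \<le> Suc (m div 2)"
    using "3.IH"(2) by (intro order_trans[OF degree_mult_le]) auto
  moreover have "Suc m div 2 \<le> Suc (m div 2)"
    by presburger
  ultimately show ?case
    using "3.IH"(1) by (auto intro!: degree_add_le)
qed auto

lemma coeff_0_fib_poly: "coeff (fib_poly m) 0 = 1"
  by (induction m rule: fib_poly.induct) auto

lemma coeff_1_fib_poly: "coeff (fib_poly (Suc m)) 1 = real m"
proof (induction "Suc m" arbitrary: m rule: fib_poly.induct)
  case (3 m)
  then show ?case
    using coeff_0_fib_poly[of m] by (simp add: coeff_pCons)
qed auto

text \<open>This is the binomial coefficient \<open>m choose 2\<close>, by strong induction because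
  the recurrence reaches back two steps. Together with the linear coefficient it determines the sum
  of the squared root weights.\<close>

lemma coeff_2_fib_poly: "coeff (fib_poly (Suc (Suc m))) 2 = real m * (real m - 1) / 2"
proof (induction m rule: less_induct)
  case (less m)
  consider "m = 0" | "m = 1" | k where "m = Suc (Suc k)"
    by (metis One_nat_def not0_implies_Suc)
  then show ?case
  proof cases
    case 3
    have "coeff (fib_poly (Suc (Suc m))) 2 = coeff (fib_poly (Suc m)) 2 + coeff (fib_poly m) 1"
      by (simp add: coeff_pCons numeral_2_eq_2)
    then show ?thesis
      using less.IH[of "Suc k"] coeff_1_fib_poly[of "Suc k"] 3 by (simp add: field_simps)
  qed (simp_all add: numeral_2_eq_2 numeral_poly coeff_pCons)
qed

text \<open>With \<open>u = -1 / (4 cos\<^sup>2 \<theta>)\<close> the recurrence turns into the one of the Chebyshev polynomials of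
  the second kind; this is where the roots of \<^const>\<open>fib_poly\<close> come from.\<close>

lemma poly_fib_poly_trig:
  assumes "cos \<theta> \<noteq> 0"
  shows "poly (fib_poly m) (- (1 / (4 * (cos \<theta>)\<^sup>2))) * sin \<theta> * (2 * cos \<theta>) ^ m = sin (real (Suc m) * \<theta>)"
proof (induction m rule: fib_poly.induct)
  case 2
  then show ?case by (simp add: sin_double)
next
  case (3 m)
  let ?u = "- (1 / (4 * (cos \<theta>)\<^sup>2))" and ?c = "2 * cos \<theta>"
  have u: "?u * ?c ^ 2 = - 1"
    using assms by (simp add: field_simps power2_eq_square)
  have "poly (fib_poly (Suc (Suc m))) ?u * sin \<theta> * ?c ^ Suc (Suc m)
     = (poly (fib_poly (Suc m)) ?u * sin \<theta> * ?c ^ Suc m) * ?c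
       + (poly (fib_poly m) ?u * sin \<theta> * ?c ^ m) * (?u * ?c ^ 2)"
    by (simp add: algebra_simps power2_eq_square)
  also have "\<dots> = sin (real (Suc (Suc m)) * \<theta>) * ?c - sin (real (Suc m) * \<theta>)"
    unfolding "3.IH" u by simp
  also have "\<dots> = sin (real (Suc (Suc (Suc m))) * \<theta>)"
  proof -
    have "sin (real (Suc (Suc m)) * \<theta> + \<theta>) + sin (real (Suc (Suc m)) * \<theta> - \<theta>)
        = 2 * (sin (real (Suc (Suc m)) * \<theta>) * cos \<theta>)"
      by (simp only: sin_add sin_diff)
    moreover have "real (Suc (Suc m)) * \<theta> + \<theta> = real (Suc (Suc (Suc m))) * \<theta>"
      "real (Suc (Suc m)) * \<theta> - \<theta> = real (Suc m) * \<theta>"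
      by (simp_all add: algebra_simps)
    ultimately show ?thesis
      by (simp only:)
  qed
  finally show ?case .
qed simp

text \<open>The zeros of sin ((m + 1) \<theta>) in (0, pi/2) are the angles with k < m div 2; the
  shift \<open>Suc k\<close> leaves out the zero at 0.\<close>

definition fib_angle :: "nat \<Rightarrow> nat \<Rightarrow> real" where
  "fib_angle m k = pi * real (Suc k) / real (Suc m)"

text \<open>The negative reciprocal of a root, so that the corresponding linear factor 1 + weight *
  X has constant term 1.\<close>

definition fib_weight :: "nat \<Rightarrow> nat \<Rightarrow> real" where
  "fib_weight m k = 4 * (cos (fib_angle m k))\<^sup>2"

lemma fib_weight_le: "fib_weight m k \<le> 4"
  by (simp add: fib_weight_def power_le_one_iff abs_square_le_1)

lemma fib_weight_nonneg: "0 \<le> fib_weight m k"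
  by (simp add: fib_weight_def)

lemma fib_angle_bounds:
  assumes "k < m div 2"
  shows "0 < fib_angle m k" "fib_angle m k < pi / 2"
proof -
  have "2 * Suc k < Suc m"
    using assms by presburger
  then have "real (Suc k) / real (Suc m) < 1 / 2"
    by (simp add: field_simps)
  then have "pi * (real (Suc k) / real (Suc m)) < pi * (1 / 2)"
    by (intro mult_strict_left_mono) auto
  then show "fib_angle m k < pi / 2"
    by (simp add: fib_angle_def)
qed (simp add: fib_angle_def)

lemma cos_fib_angle_pos: "k < m div 2 \<Longrightarrow> 0 < cos (fib_angle m k)"
  using fib_angle_bounds[of k m] by (intro cos_gt_zero)

lemma fib_weight_pos: "k < m div 2 \<Longrightarrow> 0 < fib_weight m k"
  using cos_fib_angle_pos[of k m] by (simp add: fib_weight_def)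

lemma inj_on_fib_weight: "inj_on (fib_weight m) {..<m div 2}"
proof (rule inj_onI)
  fix j k assume "j \<in> {..<m div 2}" "k \<in> {..<m div 2}" and eq: "fib_weight m j = fib_weight m k"
  then have jk: "j < m div 2" "k < m div 2" by auto
  have "(cos (fib_angle m j))\<^sup>2 = (cos (fib_angle m k))\<^sup>2"
    using eq by (simp add: fib_weight_def)
  then have "cos (fib_angle m j) = cos (fib_angle m k)"
    by (rule power2_eq_imp_eq) (use jk[THEN cos_fib_angle_pos] in simp_all)
  then have "fib_angle m j = fib_angle m k"
    using jk[THEN fib_angle_bounds(1)] jk[THEN fib_angle_bounds(2)]
    by - (rule cos_inj_pi; linarith)
  then show "j = k"
    unfolding fib_angle_def divide_cancel_right mult_cancel_left
    using pi_neq_zero by (metis of_nat_eq_iff nat.inject of_nat_neq_0)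
qed

text \<open>At these angles sin ((m + 1) \<theta>) = sin (pi (k + 1)) = 0, while sin \<theta> and
  cos \<theta> are positive, so the polynomial factor must vanish.\<close>

lemma poly_fib_poly_root:
  assumes "k < m div 2"
  shows "poly (fib_poly m) (- (1 / fib_weight m k)) = 0"
proof -
  have "cos (fib_angle m k) > 0" "sin (fib_angle m k) > 0"
    using fib_angle_bounds[OF assms] cos_fib_angle_pos[OF assms] by (auto intro!: sin_gt_zero)
  moreover have "real (Suc m) * fib_angle m k = pi * real (Suc k)"
    by (simp add: fib_angle_def)
  then have "sin (real (Suc m) * fib_angle m k) = 0"
    by (simp only: sin_npi2)
  ultimately have "poly (fib_poly m) (- (1 / (4 * (cos (fib_angle m k))\<^sup>2))) * sin (fib_angle m k) *
      (2 * cos (fib_angle m k)) ^ m = 0"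
    using poly_fib_poly_trig[of "fib_angle m k" m] by (simp only:)
  then show ?thesis
    using \<open>cos (fib_angle m k) > 0\<close> \<open>sin (fib_angle m k) > 0\<close> by (simp add: fib_weight_def)
qed

text \<open>Both sides have degree at most m div 2. They agree at the m div 2 distinct roots and
  also at 0, where both equal 1, so a nonzero difference would have too many zeros.\<close>

lemma fib_poly_factor: "fib_poly m = (\<Prod>k<m div 2. [:1, fib_weight m k:])"
proof (rule ccontr)
  let ?Q = "\<Prod>k<m div 2. [:1, fib_weight m k:]"
  let ?R = "insert 0 ((\<lambda>k. - (1 / fib_weight m k)) ` {..<m div 2})"
  assume "fib_poly m \<noteq> ?Q"
  then have nz: "fib_poly m - ?Q \<noteq> 0" by simp
  have "degree ?Q \<le> (\<Sum>k<m div 2. 1)"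
    by (intro order_trans[OF degree_prod_sum_le] sum_mono) auto
  then have deg: "degree (fib_poly m - ?Q) \<le> m div 2"
    using degree_fib_poly[of m] by (intro degree_diff_le) auto
  have "poly ?Q 0 = 1" "poly (fib_poly m) 0 = 1"
    using coeff_0_fib_poly[of m] by (simp add: poly_prod, simp add: poly_0_coeff_0)
  moreover have "poly ?Q (- (1 / fib_weight m k)) = 0" if "k < m div 2" for k
    using that fib_weight_pos[OF that] by (auto simp: poly_prod intro!: bexI[of _ k])
  ultimately have "?R \<subseteq> {x. poly (fib_poly m - ?Q) x = 0}"
    by (auto simp: poly_fib_poly_root)
  then have "card ?R \<le> card {x. poly (fib_poly m - ?Q) x = 0}"
    using poly_roots_finite[OF nz] by (rule card_mono[rotated])
  also have "\<dots> \<le> m div 2"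
    using card_poly_roots_bound[OF nz] deg by linarith
  finally have "card ?R \<le> m div 2" .
  moreover have "card ?R = Suc (m div 2)"
  proof -
    have "inj_on (\<lambda>k. - (1 / fib_weight m k)) {..<m div 2}"
      using inj_on_fib_weight[of m] by (auto simp: inj_on_def)
    moreover have "0 \<notin> (\<lambda>k. - (1 / fib_weight m k)) ` {..<m div 2}"
      using fib_weight_pos[of _ m] by force
    ultimately show ?thesis
      by (simp add: card_image)
  qed
  ultimately show False by simp
qed

text \<open>The coefficients are elementary symmetric functions of the \<open>c k\<close>; the third
  claim is Newton's identity 2 e_2 = e_1^2 - p_2.\<close>

lemma coeff_prod_linear_poly:
  fixes c :: "nat \<Rightarrow> real"
  shows "coeff (\<Prod>k<d. [:1, c k:]) 0 = 1"
    and "coeff (\<Prod>k<d. [:1, c k:]) 1 = (\<Sum>k<d. c k)"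
    and "2 * coeff (\<Prod>k<d. [:1, c k:]) 2 = (\<Sum>k<d. c k)\<^sup>2 - (\<Sum>k<d. (c k)\<^sup>2)"
proof -
  show c0: "coeff (\<Prod>k<d. [:1, c k:]) 0 = 1" for d
    by (induction d) (simp_all add: mult.commute[of "prod _ _"])
  show c1: "coeff (\<Prod>k<d. [:1, c k:]) 1 = (\<Sum>k<d. c k)" for d
    by (induction d) (simp_all add: mult.commute[of "prod _ _"] c0 coeff_pCons)
  show "2 * coeff (\<Prod>k<d. [:1, c k:]) 2 = (\<Sum>k<d. c k)\<^sup>2 - (\<Sum>k<d. (c k)\<^sup>2)"
  proof (induction d)
    case (Suc d)
    have "coeff (\<Prod>k<Suc d. [:1, c k:]) 2 = coeff (\<Prod>k<d. [:1, c k:]) 2 + c d * (\<Sum>k<d. c k)"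
      using c1[of d] by (simp add: mult.commute[of "prod _ _"] coeff_pCons numeral_2_eq_2)
    with Suc show ?case
      by (simp add: power2_eq_square algebra_simps)
  qed (simp add: numeral_2_eq_2)
qed

lemma sum_fib_weight: "(\<Sum>k<Suc n div 2. fib_weight (Suc n) k) = real n"
  unfolding coeff_prod_linear_poly(2)[symmetric] fib_poly_factor[symmetric] by (rule coeff_1_fib_poly)

text \<open>By Newton's identity the sum is n^2 - (n - 1) (n - 2). Its value is the denominator in
  \<open>Ntil\<close>: a binomial distribution with n^2 / (3 n - 2) trials and mean n alpha would
  have the same sum of squared success probabilities as S.\<close>

lemma sum_fib_weight_sq:
  assumes "n > 0"
  shows "(\<Sum>k<Suc n div 2. (fib_weight (Suc n) k)\<^sup>2) = 3 * real n - 2"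
proof -
  obtain m where m: "n = Suc m"
    using assms by (cases n) auto
  have "2 * coeff (fib_poly (Suc n)) 2 = (real n)\<^sup>2 - (\<Sum>k<Suc n div 2. (fib_weight (Suc n) k)\<^sup>2)"
    unfolding fib_poly_factor coeff_prod_linear_poly(3) sum_fib_weight ..
  moreover have "2 * coeff (fib_poly (Suc n)) 2 = real m * (real m - 1)"
    unfolding m coeff_2_fib_poly by simp
  ultimately show ?thesis
    by (simp add: m power2_eq_square algebra_simps)
qed

section \<open>The law of S as a product of linear factors\<close>

lemma finite_set_eta_pmf: "finite (set_pmf (eta_pmf n p))"
  unfolding eta_pmf_def by (subst set_Pi_pmf) (auto intro!: finite_PiE_dflt simp: comp_def)

text \<open>The coordinates for \<open>Suc n\<close> are 1 to n + 2, so the new one, independent of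
  the others, has index n + 2.\<close>

lemma expectation_eta_pmf_Suc:
  fixes f :: "(nat \<Rightarrow> bool) \<Rightarrow> real"
  assumes "0 \<le> p" "p \<le> 1"
  shows "measure_pmf.expectation (eta_pmf (Suc n) p) f =
     p * measure_pmf.expectation (eta_pmf n p) (\<lambda>\<eta>. f (\<eta>(n + 2 := True))) +
     (1 - p) * measure_pmf.expectation (eta_pmf n p) (\<lambda>\<eta>. f (\<eta>(n + 2 := False)))"
proof -
  have ins: "{1..Suc n + 1} = insert (n + 2) {1..n + 1}"
    by auto
  have "eta_pmf (Suc n) p = bernoulli_pmf p \<bind> (\<lambda>b. map_pmf (\<lambda>\<eta>. \<eta>(n + 2 := b)) (eta_pmf n p))"
    unfolding eta_pmf_def ins by (subst Pi_pmf_insert') (auto simp: map_pmf_def)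
  then have "measure_pmf.expectation (eta_pmf (Suc n) p) f =
     (\<Sum>b\<in>UNIV. pmf (bernoulli_pmf p) b *\<^sub>R
        measure_pmf.expectation (map_pmf (\<lambda>\<eta>. \<eta>(n + 2 := b)) (eta_pmf n p)) f)"
    by (simp only:) (rule pmf_expectation_bind, auto simp: finite_set_eta_pmf)
  then show ?thesis
    using assms by (simp add: UNIV_bool)
qed

lemma Stil_upd: "Stil n (\<eta>(Suc (Suc n) := b)) = Stil n \<eta>"
  unfolding Stil_def by (intro sum.cong) auto

lemma Stil_Suc: "Stil (Suc n) \<eta> = Stil n \<eta> + of_bool (\<eta> (Suc n)) * (1 - of_bool (\<eta> (n + 2)))"
  by (simp add: Stil_def)

lemma Stil_le: "Stil n \<eta> \<le> n"
proof -
  have "Stil n \<eta> \<le> (\<Sum>j=1..n. 1)"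
    unfolding Stil_def by (intro sum_mono) auto
  then show ?thesis by simp
qed

text \<open>Conditioning on the last trial couples the generating function with its restriction to
  \<open>\<eta>\<^bsub>n+1\<^esub> = 1\<close>, and that restriction is \<open>p\<close> times the generating function for \<open>n - 1\<close>.\<close>

lemma pgf_Stil:
  assumes p: "0 \<le> p" "p \<le> 1"
  shows "measure_pmf.expectation (eta_pmf n p) (\<lambda>\<eta>. z ^ Stil n \<eta>) = poly (fib_poly (Suc n)) (alpha p * (z - 1))"
proof -
  define g where "g = (\<lambda>n. measure_pmf.expectation (eta_pmf n p) (\<lambda>\<eta>. z ^ Stil n \<eta>))"
  define k where "k = (\<lambda>n. measure_pmf.expectation (eta_pmf n p) (\<lambda>\<eta>. of_bool (\<eta> (Suc n)) * z ^ Stil n \<eta>))"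
  have int: "integrable (measure_pmf (eta_pmf n p)) h" for n and h :: "_ \<Rightarrow> real"
    by (intro integrable_measure_pmf_finite finite_set_eta_pmf)
  \<comment> \<open>On the event that trial n + 2 succeeds, the last summand of
    \<open>Stil (Suc n)\<close> is 0, so only \<open>Stil n\<close> remains, and it is independent
    of that trial.\<close>
  have k_Suc: "k (Suc n) = p * g n" for n
    unfolding k_def g_def expectation_eta_pmf_Suc[OF p] by (simp add: Stil_Suc Stil_upd)
  have g_Suc: "g (Suc n) = g n + (1 - p) * (z - 1) * k n" for n
  proof -
    have "z ^ Stil (Suc n) (\<eta>(n + 2 := True)) = z ^ Stil n \<eta>" for \<eta>
      using Stil_upd[of n \<eta> True] by (simp add: Stil_Suc)
    moreover have "z ^ Stil (Suc n) (\<eta>(n + 2 := False)) = z ^ Stil n \<eta> + (z - 1) * (of_bool (\<eta> (Suc n)) * z ^ Stil n \<eta>)" for \<eta>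
      using Stil_upd[of n \<eta> False] by (simp add: Stil_Suc algebra_simps)
    ultimately have "g (Suc n) = p * g n + (1 - p) * (g n + (z - 1) * k n)"
      unfolding g_def k_def expectation_eta_pmf_Suc[OF p] using int by simp
    then show ?thesis by (simp add: algebra_simps)
  qed
  have g0: "g 0 = 1"
    by (simp add: g_def Stil_def)
  have k0: "k 0 = p"
    using p by (simp add: k_def Stil_def eta_pmf_def Pi_pmf_singleton)
  have "g n = poly (fib_poly (Suc n)) (alpha p * (z - 1))" for n
  proof (induction n rule: fib_poly.induct)
    case 2
    then show ?case by (simp add: g_Suc g0 k0 alpha_def)
  next
    case (3 n)
    have "g (Suc (Suc n)) = g (Suc n) + alpha p * (z - 1) * g n"
      by (simp add: g_Suc k_Suc alpha_def)
    then show ?case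
      unfolding 3 by (simp add: algebra_simps)
  qed (simp add: g0)
  then show ?thesis
    by (simp add: g_def)
qed

text \<open>The generating function of S and the product agree at every real z, hence as
  polynomials: a factor 1 + weight * alpha (z - 1) is the polynomial with coefficients 1 - alpha *
  weight and alpha * weight. The sum up to n captures the whole law because S <= n.\<close>

lemma probS_eq_coeff:
  assumes p: "0 \<le> p" "p \<le> 1"
  shows "probS n p x = coeff (\<Prod>k<Suc n div 2. [:1 - alpha p * fib_weight (Suc n) k, alpha p * fib_weight (Suc n) k:]) x"
    (is "_ = coeff ?G x")
proof -
  let ?Q = "\<Sum>i\<le>n. monom (probS n p i) i"
  have "poly ?Q z = poly ?G z" for z
  proof -
    have "z ^ Stil n \<eta> = (\<Sum>i\<le>n. indicator {\<eta>. Stil n \<eta> = i} \<eta> * z ^ i)" for \<eta>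
    proof -
      have "(\<Sum>i\<le>n. indicator {\<eta>. Stil n \<eta> = i} \<eta> * z ^ i) = (\<Sum>i\<le>n. if i = Stil n \<eta> then z ^ i else 0)"
        by (intro sum.cong) (auto simp: indicator_def)
      then show ?thesis
        using Stil_le[of n \<eta>] by simp
    qed
    then have "measure_pmf.expectation (eta_pmf n p) (\<lambda>\<eta>. z ^ Stil n \<eta>) = (\<Sum>i\<le>n. probS n p i * z ^ i)"
      unfolding probS_def
      by (simp only: Bochner_Integration.integral_sum integrable_measure_pmf_finite finite_set_eta_pmf) simp
    moreover have "poly ?G z = poly (fib_poly (Suc n)) (alpha p * (z - 1))"
      unfolding fib_poly_factor poly_prod by (intro prod.cong) (simp_all add: algebra_simps)
    ultimately show ?thesis
      by (simp add: pgf_Stil[OF p] poly_sum poly_monom)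
  qed
  then have "?Q = ?G"
    by (simp add: poly_eq_poly_eq_iff[symmetric] fun_eq_iff)
  moreover have "coeff ?Q x = probS n p x"
  proof (cases "x \<le> n")
    case False
    then have empty: "{\<eta>. Stil n \<eta> = x} = {}"
      using Stil_le[of n] by auto
    have "coeff ?Q x = 0"
      using False by (simp add: coeff_sum)
    then show ?thesis
      by (simp add: probS_def empty)
  qed (simp add: coeff_sum)
  ultimately show ?thesis by simp
qed

text \<open>For x > N both sides are 0: the binomial coefficient vanishes, and the product has
  degree at most N.\<close>

lemma BI_eq_coeff: "BI N q x = coeff (\<Prod>k<N. [:1 - q, q:]) x"
  by (cases "x \<le> N")
     (simp_all add: BI_def coeff_linear_poly_power binomial_eq_0 coeff_eq_0 degree_power_eq)

section \<open>Exponential tilting\<close>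

text \<open>The remainder f has derivative t^2 / (1 + t), which lies between 0 and 3 t^2 for t >=
  -1/2. Hence f and t^3 - f are nondecreasing, and both vanish at 0.\<close>

lemma abs_ln_taylor2_le:
  fixes y :: real
  assumes "\<bar>y\<bar> \<le> 1 / 2"
  shows "\<bar>ln (1 + y) - (y - y\<^sup>2 / 2)\<bar> \<le> \<bar>y\<bar> ^ 3"
proof -
  define f where "f = (\<lambda>y::real. ln (1 + y) - (y - y\<^sup>2 / 2))"
  have df: "(f has_real_derivative t\<^sup>2 / (1 + t)) (at t)" if "- (1 / 2) \<le> t" for t
    unfolding f_def using that
    by (auto intro!: derivative_eq_intros simp: field_simps power2_eq_square)
  have f_mono: "f a \<le> f b" if "- (1 / 2) \<le> a" "a \<le> b" for a b
  proof (rule DERIV_nonneg_imp_nondecreasing[OF that(2)])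
    fix t assume "a \<le> t" "t \<le> b"
    then have "- (1 / 2) \<le> t" using that by simp
    then show "\<exists>D. (f has_real_derivative D) (at t) \<and> 0 \<le> D"
      using df[of t] by (intro exI[of _ "t\<^sup>2 / (1 + t)"]) auto
  qed
  have g_mono: "a ^ 3 - f a \<le> b ^ 3 - f b" if "- (1 / 2) \<le> a" "a \<le> b" for a b
  proof (rule DERIV_nonneg_imp_nondecreasing[OF that(2), of "\<lambda>t. t ^ 3 - f t"])
    fix t assume "a \<le> t" "t \<le> b"
    then have t: "- (1 / 2) \<le> t" using that by simp
    have "((\<lambda>t. t ^ 3 - f t) has_real_derivative 3 * t\<^sup>2 - t\<^sup>2 / (1 + t)) (at t)"
      using df[OF t] by (auto intro!: derivative_eq_intros)
    moreover have "t\<^sup>2 / (1 + t) \<le> t\<^sup>2 / (1 / 2)"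
      using t by (intro divide_left_mono) auto
    then have "t\<^sup>2 / (1 + t) \<le> 3 * t\<^sup>2"
      by (rule order_trans) simp
    then have "0 \<le> 3 * t\<^sup>2 - t\<^sup>2 / (1 + t)"
      by simp
    ultimately show "\<exists>D. ((\<lambda>t. t ^ 3 - f t) has_real_derivative D) (at t) \<and> 0 \<le> D"
      by blast
  qed
  have f0: "f 0 = 0"
    by (simp add: f_def)
  have "\<bar>f y\<bar> \<le> \<bar>y\<bar> ^ 3"
  proof (cases "0 \<le> y")
    case True
    then show ?thesis
      using f_mono[of 0 y] g_mono[of 0 y] f0 by simp
  next
    case False
    then have "f y \<le> 0" "y ^ 3 - f y \<le> 0"
      using f_mono[of y 0] g_mono[of y 0] f0 assms by simp_all
    moreover have "\<bar>y\<bar> ^ 3 = - (y ^ 3)"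
      using False by (simp add: power3_eq_cube)
    ultimately show ?thesis by simp
  qed
  then show ?thesis
    by (simp add: f_def)
qed

lemma abs_mult_le_half:
  fixes r w \<rho> :: real
  assumes "0 \<le> r" "r \<le> \<rho>" "\<rho> \<le> 1 / 2" "\<bar>w\<bar> \<le> 1"
  shows "\<bar>r * w\<bar> \<le> 1 / 2"
proof -
  have "\<bar>r * w\<bar> = r * \<bar>w\<bar>"
    using assms by (simp add: abs_mult)
  also have "\<dots> \<le> (1 / 2) * 1"
    using assms by (intro mult_mono) auto
  finally show ?thesis by simp
qed

text \<open>Sum the expansion of ln (1 + r w) over the factors. Bounding r^3 by \<rho>^2 r expresses
  the cubic error through the sum of the \<open>r k\<close> alone.\<close>

lemma ln_prod_linear_approx:
  fixes r :: "nat \<Rightarrow> real"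
  assumes r: "\<And>k. k < d \<Longrightarrow> 0 \<le> r k \<and> r k \<le> \<rho>" and "\<rho> \<le> 1 / 2" "\<bar>w\<bar> \<le> 1"
  shows "0 < (\<Prod>k<d. 1 + r k * w)"
    and "\<bar>ln (\<Prod>k<d. 1 + r k * w) - (w * (\<Sum>k<d. r k) - w\<^sup>2 / 2 * (\<Sum>k<d. (r k)\<^sup>2))\<bar>
           \<le> \<bar>w\<bar> ^ 3 * \<rho>\<^sup>2 * (\<Sum>k<d. r k)"
proof -
  have half: "\<bar>r k * w\<bar> \<le> 1 / 2" if "k < d" for k
    using r[OF that] assms by (intro abs_mult_le_half) auto
  then have pos: "1 + r k * w > 0" if "k < d" for k
    using that by (fastforce simp: abs_le_iff)
  then show "0 < (\<Prod>k<d. 1 + r k * w)"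
    by (intro prod_pos) auto
  have "ln (\<Prod>k<d. 1 + r k * w) = (\<Sum>k<d. ln (1 + r k * w))"
    by (intro ln_prod) (use pos in force)+
  then have "\<bar>ln (\<Prod>k<d. 1 + r k * w) - (w * (\<Sum>k<d. r k) - w\<^sup>2 / 2 * (\<Sum>k<d. (r k)\<^sup>2))\<bar>
      = \<bar>\<Sum>k<d. ln (1 + r k * w) - (r k * w - (r k * w)\<^sup>2 / 2)\<bar>"
    by (simp add: sum_subtractf sum_distrib_left power_mult_distrib mult.commute)
  also have "\<dots> \<le> (\<Sum>k<d. \<bar>w\<bar> ^ 3 * \<rho>\<^sup>2 * r k)"
  proof (intro order_trans[OF sum_abs] sum_mono)
    fix k assume "k \<in> {..<d}"
    then have k: "k < d" by simp
    have "\<bar>ln (1 + r k * w) - (r k * w - (r k * w)\<^sup>2 / 2)\<bar> \<le> \<bar>r k * w\<bar> ^ 3"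
      using half[OF k] by (rule abs_ln_taylor2_le)
    also have "\<dots> = \<bar>w\<bar> ^ 3 * (r k)\<^sup>2 * r k"
      using r[OF k] by (simp add: abs_mult eval_nat_numeral)
    also have "\<dots> \<le> \<bar>w\<bar> ^ 3 * \<rho>\<^sup>2 * r k"
      using r[OF k] by (intro mult_mono power_mono) auto
    finally show "\<bar>ln (1 + r k * w) - (r k * w - (r k * w)\<^sup>2 / 2)\<bar> \<le> \<bar>w\<bar> ^ 3 * \<rho>\<^sup>2 * r k" .
  qed
  finally show "\<bar>ln (\<Prod>k<d. 1 + r k * w) - (w * (\<Sum>k<d. r k) - w\<^sup>2 / 2 * (\<Sum>k<d. (r k)\<^sup>2))\<bar>
           \<le> \<bar>w\<bar> ^ 3 * \<rho>\<^sup>2 * (\<Sum>k<d. r k)"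
    by (simp add: sum_distrib_left)
qed

text \<open>Use 1 / (1 + r w) = 1 - r w + (r w)^2 / (1 + r w). The factor 4 comes from 1 + w <= 2
  and 1 + r w >= 1/2.\<close>

lemma tilted_mean_approx:
  fixes r :: "nat \<Rightarrow> real"
  assumes r: "\<And>k. k < d \<Longrightarrow> 0 \<le> r k \<and> r k \<le> \<rho>" and "\<rho> \<le> 1 / 2" "\<bar>w\<bar> \<le> 1"
  shows "\<bar>(\<Sum>k<d. r k * (1 + w) / (1 + r k * w)) - (1 + w) * ((\<Sum>k<d. r k) - w * (\<Sum>k<d. (r k)\<^sup>2))\<bar>
           \<le> 4 * w\<^sup>2 * \<rho>\<^sup>2 * (\<Sum>k<d. r k)"
proof -
  have "(1 + w) * ((\<Sum>k<d. r k) - w * (\<Sum>k<d. (r k)\<^sup>2)) = (\<Sum>k<d. (1 + w) * (r k - w * (r k)\<^sup>2))"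
    by (simp add: sum_subtractf flip: sum_distrib_left)
  then have "\<bar>(\<Sum>k<d. r k * (1 + w) / (1 + r k * w)) - (1 + w) * ((\<Sum>k<d. r k) - w * (\<Sum>k<d. (r k)\<^sup>2))\<bar>
     = \<bar>\<Sum>k<d. r k * (1 + w) / (1 + r k * w) - (1 + w) * (r k - w * (r k)\<^sup>2)\<bar>"
    by (simp only: sum_subtractf)
  also have "\<dots> \<le> (\<Sum>k<d. 4 * w\<^sup>2 * \<rho>\<^sup>2 * r k)"
  proof (intro order_trans[OF sum_abs] sum_mono)
    fix k assume "k \<in> {..<d}"
    then have rk: "0 \<le> r k" "r k \<le> \<rho>"
      using r by auto
    have "\<bar>r k * w\<bar> \<le> 1 / 2"
      using rk assms by (intro abs_mult_le_half) auto
    then have half: "1 / 2 \<le> 1 + r k * w"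
      by (simp add: abs_le_iff)
    then have eq: "r k * (1 + w) / (1 + r k * w) - (1 + w) * (r k - w * (r k)\<^sup>2)
        = r k * ((1 + w) * ((w\<^sup>2 * (r k)\<^sup>2) / (1 + r k * w)))"
      by (simp add: field_simps power2_eq_square)
    have "\<bar>r k * (1 + w) / (1 + r k * w) - (1 + w) * (r k - w * (r k)\<^sup>2)\<bar>
        = r k * ((1 + w) * ((w\<^sup>2 * (r k)\<^sup>2) / (1 + r k * w)))"
      unfolding eq using half rk assms by (intro abs_of_nonneg mult_nonneg_nonneg divide_nonneg_nonneg) auto
    also have "\<dots> \<le> r k * (2 * ((w\<^sup>2 * \<rho>\<^sup>2) / (1 / 2)))"
      using half rk assms by (intro mult_left_mono mult_mono frac_le power_mono) auto
    finally show "\<bar>r k * (1 + w) / (1 + r k * w) - (1 + w) * (r k - w * (r k)\<^sup>2)\<bar> \<le> 4 * w\<^sup>2 * \<rho>\<^sup>2 * r k"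
      by (simp add: algebra_simps)
  qed
  finally show ?thesis
    by (simp add: sum_distrib_left)
qed

text \<open>The tilted variance is r (1 + w) (1 - r) / (1 + r w)^2. The factors multiplying r in the
  bounds depend only on \<rho> and w and tend to 1 as these tend to 0.\<close>

lemma tilted_variance_bounds:
  fixes r w \<rho> :: real
  assumes r: "0 \<le> r" "r \<le> \<rho>" and "\<rho> \<le> 1 / 2" "\<bar>w\<bar> \<le> 1 / 2"
  defines "r' \<equiv> r * (1 + w) / (1 + r * w)"
  shows "0 \<le> r'" "r' \<le> 1"
    and "r * ((1 - \<bar>w\<bar>) * (1 - \<rho>) / (1 + \<rho> * \<bar>w\<bar>)\<^sup>2) \<le> r' * (1 - r')"
    and "r' * (1 - r') \<le> r * ((1 + \<bar>w\<bar>) / (1 - \<rho> * \<bar>w\<bar>)\<^sup>2)"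
proof -
  have rw: "r * \<bar>w\<bar> \<le> \<rho> * \<bar>w\<bar>" and \<rho>w: "\<rho> * \<bar>w\<bar> \<le> (1 / 2) * (1 / 2)"
    by (use assms(1-4) in \<open>intro mult_mono; simp\<close>)+
  have "\<bar>r * w\<bar> = r * \<bar>w\<bar>"
    using r by (simp add: abs_mult)
  then have lo: "1 - \<rho> * \<bar>w\<bar> \<le> 1 + r * w" and hi: "1 + r * w \<le> 1 + \<rho> * \<bar>w\<bar>"
    using rw by linarith+
  have pos: "0 < 1 - \<rho> * \<bar>w\<bar>" "0 < 1 + r * w"
    using \<rho>w lo by simp_all
  have w: "1 - \<bar>w\<bar> \<le> 1 + w" "1 + w \<le> 1 + \<bar>w\<bar>" "0 \<le> 1 - \<bar>w\<bar>" "0 \<le> 1 + w"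
    using assms by auto
  show "0 \<le> r'"
    using r w pos by (simp add: r'_def)
  have "r * (1 + w) \<le> 1 + r * w"
    using r assms by (simp add: algebra_simps)
  then show "r' \<le> 1"
    using pos by (simp add: r'_def)
  have eq: "r' * (1 - r') = r * ((1 + w) * (1 - r) / (1 + r * w)\<^sup>2)"
    using pos by (simp add: r'_def field_simps power2_eq_square)
  show "r * ((1 - \<bar>w\<bar>) * (1 - \<rho>) / (1 + \<rho> * \<bar>w\<bar>)\<^sup>2) \<le> r' * (1 - r')"
    unfolding eq using assms(1-4) w lo hi pos
    by (intro mult_left_mono frac_le mult_mono power_mono) auto
  show "r' * (1 - r') \<le> r * ((1 + \<bar>w\<bar>) / (1 - \<rho> * \<bar>w\<bar>)\<^sup>2)"
  proof -
    have "(1 + w) * (1 - r) \<le> (1 + \<bar>w\<bar>) * 1"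
      using assms(1-4) w by (intro mult_mono) auto
    then show ?thesis
      unfolding eq using assms(1-4) w lo pos
      by (intro mult_left_mono frac_le power_mono) auto
  qed
qed

section \<open>Local limits after tilting and the ratio of two coefficients\<close>

text \<open>Since \<rho> and w tend to 0, the tilted variance is asymptotic to the untilted mean
  \<open>A\<close>. The local limit theorem therefore applies to the tilted family with
  normalisation sqrt A, and the tilting identity carries it back.\<close>

lemma tilted_llt:
  fixes r :: "nat \<Rightarrow> nat \<Rightarrow> real" and d x :: "nat \<Rightarrow> nat" and w \<rho> :: "nat \<Rightarrow> real"
  defines "A \<equiv> \<lambda>n. \<Sum>k<d n. r n k"
  assumes r: "eventually (\<lambda>n. \<forall>k<d n. 0 \<le> r n k \<and> r n k \<le> \<rho> n) sequentially"
    and \<rho>: "\<rho> \<longlonglongrightarrow> 0" and w: "w \<longlonglongrightarrow> 0"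
    and A: "filterlim A at_top sequentially"
    and x: "(\<lambda>n. (real (x n) - (\<Sum>k<d n. r n k * (1 + w n) / (1 + r n k * w n))) / sqrt (A n)) \<longlonglongrightarrow> 0"
  shows "(\<lambda>n. sqrt (A n) * (coeff (\<Prod>k<d n. [:1 - r n k, r n k:]) (x n) * (1 + w n) ^ x n
              / (\<Prod>k<d n. 1 + r n k * w n))) \<longlonglongrightarrow> 1 / sqrt (2 * pi)"
proof -
  define r' where "r' = (\<lambda>n k. r n k * (1 + w n) / (1 + r n k * w n))"
  define v where "v = (\<lambda>n. \<Sum>k<d n. r' n k * (1 - r' n k))"
  have ev: "eventually (\<lambda>n. (\<forall>k<d n. 0 \<le> r n k \<and> r n k \<le> \<rho> n) \<and> \<rho> n \<le> 1 / 2 \<and> \<bar>w n\<bar> \<le> 1 / 2 \<and> 0 < A n) sequentially"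
  proof (intro eventually_conj r)
    show "eventually (\<lambda>n. \<rho> n \<le> 1 / 2) sequentially"
      using order_tendstoD(2)[OF \<rho>, of "1 / 2"] by (auto elim: eventually_mono)
    show "eventually (\<lambda>n. \<bar>w n\<bar> \<le> 1 / 2) sequentially"
      using order_tendstoD(2)[OF tendsto_rabs_zero[OF w], of "1 / 2"] by (auto elim: eventually_mono)
    show "eventually (\<lambda>n. 0 < A n) sequentially"
      using A by (auto simp: filterlim_at_top_dense)
  qed
  have v_A: "(\<lambda>n. v n / A n) \<longlonglongrightarrow> 1"
  proof (rule tendsto_sandwich)
    let ?L = "\<lambda>n. (1 - \<bar>w n\<bar>) * (1 - \<rho> n) / (1 + \<rho> n * \<bar>w n\<bar>)\<^sup>2"
    let ?U = "\<lambda>n. (1 + \<bar>w n\<bar>) / (1 - \<rho> n * \<bar>w n\<bar>)\<^sup>2"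
    show "eventually (\<lambda>n. ?L n \<le> v n / A n) sequentially"
      using ev
    proof eventually_elim
      case (elim n)
      then have "(\<Sum>k<d n. r n k * ?L n) \<le> v n"
        unfolding v_def r'_def by (intro sum_mono tilted_variance_bounds(3)) auto
      then have "A n * ?L n \<le> v n"
        by (simp only: A_def sum_distrib_right)
      then show ?case
        using elim by (simp only: pos_le_divide_eq mult.commute[of "A n"])
    qed
    show "eventually (\<lambda>n. v n / A n \<le> ?U n) sequentially"
      using ev
    proof eventually_elim
      case (elim n)
      then have "v n \<le> (\<Sum>k<d n. r n k * ?U n)"
        unfolding v_def r'_def by (intro sum_mono tilted_variance_bounds(4)) auto
      then have "v n \<le> A n * ?U n"
        by (simp only: A_def sum_distrib_right)
      then show ?case
        using elim by (simp only: pos_divide_le_eq mult.commute[of "A n"])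
    qed
    have "?L \<longlonglongrightarrow> (1 - \<bar>0\<bar>) * (1 - 0) / (1 + 0 * \<bar>0\<bar>)\<^sup>2"
      by (intro tendsto_intros \<rho> w) auto
    then show "?L \<longlonglongrightarrow> 1" by simp
    have "?U \<longlonglongrightarrow> (1 + \<bar>0\<bar>) / (1 - 0 * \<bar>0\<bar>)\<^sup>2"
      by (intro tendsto_intros \<rho> w) auto
    then show "?U \<longlonglongrightarrow> 1" by simp
  qed
  have v_top: "filterlim v at_top sequentially"
  proof (rule filterlim_cong[THEN iffD1, OF refl refl])
    show "filterlim (\<lambda>n. v n / A n * A n) at_top sequentially"
      by (rule filterlim_tendsto_pos_mult_at_top[OF v_A _ A]) simp
    show "eventually (\<lambda>n. v n / A n * A n = v n) sequentially"
      using ev by eventually_elim auto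
  qed
  have ev_v: "eventually (\<lambda>n. 0 < v n) sequentially"
    using v_top by (auto simp: filterlim_at_top_dense)
  have sqrt_ratio: "(\<lambda>n. sqrt (A n) / sqrt (v n)) \<longlonglongrightarrow> 1"
  proof -
    have "(\<lambda>n. sqrt (1 / (v n / A n))) \<longlonglongrightarrow> sqrt (1 / 1)"
      by (intro tendsto_intros v_A) auto
    then show ?thesis
      by (simp add: real_sqrt_divide)
  qed
  have "(\<lambda>n. sqrt (v n) * coeff (\<Prod>k<d n. [:1 - r' n k, r' n k:]) (x n)) \<longlonglongrightarrow> 1 / sqrt (2 * pi)"
    unfolding v_def
  proof (rule bernoulli_poly_llt)
    show "eventually (\<lambda>n. \<forall>k<d n. 0 \<le> r' n k \<and> r' n k \<le> 1) sequentially"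
      using ev
    proof eventually_elim
      case (elim n)
      then show ?case
        unfolding r'_def by (intro allI impI conjI tilted_variance_bounds(1,2)) auto
    qed
    show "filterlim (\<lambda>n. \<Sum>k<d n. r' n k * (1 - r' n k)) at_top sequentially"
      using v_top unfolding v_def .
    have "(\<lambda>n. (real (x n) - (\<Sum>k<d n. r' n k)) / sqrt (A n) * (sqrt (A n) / sqrt (v n))) \<longlonglongrightarrow> 0 * 1"
      using x sqrt_ratio unfolding r'_def by (rule tendsto_mult)
    then have "(\<lambda>n. (real (x n) - (\<Sum>k<d n. r' n k)) / sqrt (v n)) \<longlonglongrightarrow> 0 * 1"
      by (rule Lim_transform_eventually) (use ev in \<open>eventually_elim, simp\<close>)
    then show "(\<lambda>n. (real (x n) - (\<Sum>k<d n. r' n k)) / sqrt (\<Sum>k<d n. r' n k * (1 - r' n k))) \<longlonglongrightarrow> 0"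
      unfolding v_def by simp
  qed
  from tendsto_mult[OF sqrt_ratio this]
  have "(\<lambda>n. sqrt (A n) / sqrt (v n) * (sqrt (v n) * coeff (\<Prod>k<d n. [:1 - r' n k, r' n k:]) (x n)))
      \<longlonglongrightarrow> 1 / sqrt (2 * pi)"
    by simp
  moreover have "eventually (\<lambda>n. sqrt (A n) / sqrt (v n) * (sqrt (v n) * coeff (\<Prod>k<d n. [:1 - r' n k, r' n k:]) (x n))
     = sqrt (A n) * (coeff (\<Prod>k<d n. [:1 - r n k, r n k:]) (x n) * (1 + w n) ^ x n
              / (\<Prod>k<d n. 1 + r n k * w n))) sequentially"
    using ev ev_v
  proof eventually_elim
    case (elim n)
    have G: "0 < (\<Prod>k<d n. 1 + r n k * w n)"
      using elim by (intro ln_prod_linear_approx(1)[of _ _ "\<rho> n"]) auto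
    have "(\<Prod>k<d n. 1 + r n k * w n) \<noteq> 0"
      by (rule not_sym[OF less_imp_neq[OF G]])
    then have factor: "1 + r n k * w n \<noteq> 0" if "k < d n" for k
      using that by (simp add: prod_zero_iff)
    then have "coeff (\<Prod>k<d n. [:1 - r n k, r n k:]) (x n) * (1 + w n) ^ x n
        = (\<Prod>k<d n. 1 + r n k * w n) * coeff (\<Prod>k<d n. [:1 - r' n k, r' n k:]) (x n)"
      using coeff_bernoulli_poly_tilt[of "1 + w n" "d n" "r n" "x n"] elim by (auto simp: r'_def)
    then show ?case
      using factor elim by simp
  qed
  ultimately show ?thesis
    by (rule Lim_transform_eventually)
qed

text \<open>One tilt \<open>w\<close>, placing the second mean exactly at \<open>x\<close>, serves
  both families. The ratio splits into generating functions at 1 + w and tilted coefficients. The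
  two assumptions on powers of w and \<rho> control the cubic error in the logarithms and the
  quadratic error in the means relative to sqrt A.\<close>

lemma bernoulli_poly_coeff_ratio:
  fixes r s :: "nat \<Rightarrow> nat \<Rightarrow> real" and d e x :: "nat \<Rightarrow> nat" and w \<rho> A :: "nat \<Rightarrow> real"
  assumes r: "eventually (\<lambda>n. (\<forall>k<d n. 0 \<le> r n k \<and> r n k \<le> \<rho> n) \<and> (\<Sum>k<d n. r n k) = A n) sequentially"
    and s: "eventually (\<lambda>n. (\<forall>k<e n. 0 \<le> s n k \<and> s n k \<le> \<rho> n) \<and> (\<Sum>k<e n. s n k) = A n) sequentially"
    and \<rho>: "\<rho> \<longlonglongrightarrow> 0" and w: "w \<longlonglongrightarrow> 0" and A: "filterlim A at_top sequentially"
    and x: "eventually (\<lambda>n. (\<Sum>k<e n. s n k * (1 + w n) / (1 + s n k * w n)) = real (x n)) sequentially"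
    and V: "(\<lambda>n. (\<Sum>k<d n. (r n k)\<^sup>2) - (\<Sum>k<e n. (s n k)\<^sup>2)) \<longlonglongrightarrow> 0"
    and c3: "(\<lambda>n. \<bar>w n\<bar> ^ 3 * (\<rho> n)\<^sup>2 * A n) \<longlonglongrightarrow> 0"
    and c2: "(\<lambda>n. (w n)\<^sup>2 * (\<rho> n)\<^sup>2 * sqrt (A n)) \<longlonglongrightarrow> 0"
  shows "(\<lambda>n. coeff (\<Prod>k<d n. [:1 - r n k, r n k:]) (x n) / coeff (\<Prod>k<e n. [:1 - s n k, s n k:]) (x n)) \<longlonglongrightarrow> 1"
proof -
  define V where "V = (\<lambda>n. (\<Sum>k<d n. (r n k)\<^sup>2) - (\<Sum>k<e n. (s n k)\<^sup>2))"
  have V0: "V \<longlonglongrightarrow> 0"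
    using V unfolding V_def .
  define G where "G = (\<lambda>n. \<Prod>k<d n. 1 + r n k * w n)"
  define H where "H = (\<lambda>n. \<Prod>k<e n. 1 + s n k * w n)"
  define a where "a = (\<lambda>n. coeff (\<Prod>k<d n. [:1 - r n k, r n k:]) (x n))"
  define b where "b = (\<lambda>n. coeff (\<Prod>k<e n. [:1 - s n k, s n k:]) (x n))"
  have ev: "eventually (\<lambda>n. \<rho> n \<le> 1 / 2 \<and> \<bar>w n\<bar> \<le> 1 / 2 \<and> 0 < A n) sequentially"
  proof (intro eventually_conj)
    show "eventually (\<lambda>n. \<rho> n \<le> 1 / 2) sequentially"
      using order_tendstoD(2)[OF \<rho>, of "1 / 2"] by (auto elim: eventually_mono)
    show "eventually (\<lambda>n. \<bar>w n\<bar> \<le> 1 / 2) sequentially"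
      using order_tendstoD(2)[OF tendsto_rabs_zero[OF w], of "1 / 2"] by (auto elim: eventually_mono)
    show "eventually (\<lambda>n. 0 < A n) sequentially"
      using A by (auto simp: filterlim_at_top_dense)
  qed
  have GH: "eventually (\<lambda>n. 0 < G n \<and> 0 < H n) sequentially"
    using ev r s
  proof eventually_elim
    case (elim n)
    then show ?case
      unfolding G_def H_def by (intro conjI ln_prod_linear_approx(1)[of _ _ "\<rho> n"]) auto
  qed
  \<comment> \<open>The linear terms cancel because both sums equal \<open>A\<close>; the quadratic
    ones leave w^2/2 times \<open>V\<close>.\<close>
  have "(\<lambda>n. ln (G n) - ln (H n)) \<longlonglongrightarrow> 0"
  proof (rule Lim_null_comparison)
    show "eventually (\<lambda>n. norm (ln (G n) - ln (H n)) \<le> 2 * (\<bar>w n\<bar> ^ 3 * (\<rho> n)\<^sup>2 * A n) + (w n)\<^sup>2 / 2 * \<bar>V n\<bar>) sequentially"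
      using ev r s
    proof eventually_elim
      case (elim n)
      let ?e = "\<bar>w n\<bar> ^ 3 * (\<rho> n)\<^sup>2 * A n"
      have "\<bar>ln (G n) - (w n * A n - (w n)\<^sup>2 / 2 * (\<Sum>k<d n. (r n k)\<^sup>2))\<bar> \<le> ?e"
        using ln_prod_linear_approx(2)[of "d n" "r n" "\<rho> n" "w n"] elim by (auto simp: G_def)
      moreover have "\<bar>ln (H n) - (w n * A n - (w n)\<^sup>2 / 2 * (\<Sum>k<e n. (s n k)\<^sup>2))\<bar> \<le> ?e"
        using ln_prod_linear_approx(2)[of "e n" "s n" "\<rho> n" "w n"] elim by (auto simp: H_def)
      moreover have "(w n)\<^sup>2 / 2 * (\<Sum>k<d n. (r n k)\<^sup>2) = (w n)\<^sup>2 / 2 * (\<Sum>k<e n. (s n k)\<^sup>2) + (w n)\<^sup>2 / 2 * V n"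
        by (simp add: V_def algebra_simps)
      moreover have "\<bar>(w n)\<^sup>2 / 2 * V n\<bar> = (w n)\<^sup>2 / 2 * \<bar>V n\<bar>"
        by (simp add: abs_mult)
      ultimately show ?case
        unfolding real_norm_def by linarith
    qed
    have "(\<lambda>n. 2 * (\<bar>w n\<bar> ^ 3 * (\<rho> n)\<^sup>2 * A n) + (w n)\<^sup>2 / 2 * \<bar>V n\<bar>) \<longlonglongrightarrow> 2 * 0 + 0\<^sup>2 / 2 * \<bar>0\<bar>"
      by (intro tendsto_intros c3 w V0) auto
    then show "(\<lambda>n. 2 * (\<bar>w n\<bar> ^ 3 * (\<rho> n)\<^sup>2 * A n) + (w n)\<^sup>2 / 2 * \<bar>V n\<bar>) \<longlonglongrightarrow> 0"
      by simp
  qed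
  from tendsto_exp[OF this] have "(\<lambda>n. exp (ln (G n) - ln (H n))) \<longlonglongrightarrow> 1"
    by simp
  then have GH_lim: "(\<lambda>n. G n / H n) \<longlonglongrightarrow> 1"
    by (rule Lim_transform_eventually) (use GH in \<open>eventually_elim, simp add: exp_diff\<close>)
  have sqrtA: "filterlim (\<lambda>n. sqrt (A n)) at_top sequentially"
    using filterlim_compose[OF sqrt_at_top A] .
  let ?M = "\<lambda>n. \<Sum>k<d n. r n k * (1 + w n) / (1 + r n k * w n)"
  \<comment> \<open>As \<open>x\<close> is the tilted mean of the second family, the two mean
    expansions differ by (1 + w) w V and the remainders, all negligible against sqrt A.\<close>
  have mean: "(\<lambda>n. (real (x n) - ?M n) / sqrt (A n)) \<longlonglongrightarrow> 0"
  proof (rule Lim_null_comparison)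
    show "eventually (\<lambda>n. norm ((real (x n) - ?M n) / sqrt (A n))
        \<le> 8 * ((w n)\<^sup>2 * (\<rho> n)\<^sup>2 * sqrt (A n)) + \<bar>(1 + w n) * w n * V n\<bar> / sqrt (A n)) sequentially"
      using ev r s x
    proof eventually_elim
      case (elim n)
      let ?e = "4 * (w n)\<^sup>2 * (\<rho> n)\<^sup>2 * A n"
      have "\<bar>?M n - (1 + w n) * (A n - w n * (\<Sum>k<d n. (r n k)\<^sup>2))\<bar> \<le> ?e"
        using tilted_mean_approx[of "d n" "r n" "\<rho> n" "w n"] elim by auto
      moreover have "\<bar>real (x n) - (1 + w n) * (A n - w n * (\<Sum>k<e n. (s n k)\<^sup>2))\<bar> \<le> ?e"
        using tilted_mean_approx[of "e n" "s n" "\<rho> n" "w n"] elim by auto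
      moreover have "(1 + w n) * (A n - w n * (\<Sum>k<d n. (r n k)\<^sup>2))
          = (1 + w n) * (A n - w n * (\<Sum>k<e n. (s n k)\<^sup>2)) - (1 + w n) * w n * V n"
        by (simp add: V_def algebra_simps)
      ultimately have "\<bar>real (x n) - ?M n\<bar> \<le> 2 * ?e + \<bar>(1 + w n) * w n * V n\<bar>"
        by linarith
      then have "\<bar>real (x n) - ?M n\<bar> / sqrt (A n) \<le> (2 * ?e + \<bar>(1 + w n) * w n * V n\<bar>) / sqrt (A n)"
        using elim by (intro divide_right_mono) auto
      moreover have "A n / sqrt (A n) = sqrt (A n)"
        by (rule real_div_sqrt) (use elim in simp)
      then have "2 * ?e / sqrt (A n) = 8 * ((w n)\<^sup>2 * (\<rho> n)\<^sup>2 * sqrt (A n))"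
        by (simp flip: times_divide_eq_right)
      ultimately show ?case
        using elim by (simp add: add_divide_distrib)
    qed
    have "(\<lambda>n. \<bar>(1 + w n) * w n * V n\<bar> / sqrt (A n)) \<longlonglongrightarrow> 0"
      by (rule real_tendsto_divide_at_top[OF tendsto_rabs[OF tendsto_mult[OF tendsto_mult[OF tendsto_add[OF tendsto_const w] w] V0]] sqrtA])
    then have "(\<lambda>n. 8 * ((w n)\<^sup>2 * (\<rho> n)\<^sup>2 * sqrt (A n)) + \<bar>(1 + w n) * w n * V n\<bar> / sqrt (A n)) \<longlonglongrightarrow> 8 * 0 + 0"
      by (intro tendsto_intros c2)
    then show "(\<lambda>n. 8 * ((w n)\<^sup>2 * (\<rho> n)\<^sup>2 * sqrt (A n)) + \<bar>(1 + w n) * w n * V n\<bar> / sqrt (A n)) \<longlonglongrightarrow> 0"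
      by simp
  qed
  have sum_r: "eventually (\<lambda>n. A n = (\<Sum>k<d n. r n k)) sequentially"
    using r by eventually_elim simp
  have sum_s: "eventually (\<lambda>n. A n = (\<Sum>k<e n. s n k)) sequentially"
    using s by eventually_elim simp
  have "(\<lambda>n. sqrt (\<Sum>k<d n. r n k) * (a n * (1 + w n) ^ x n / G n)) \<longlonglongrightarrow> 1 / sqrt (2 * pi)"
    unfolding a_def G_def
  proof (rule tilted_llt[OF _ \<rho> w])
    show "eventually (\<lambda>n. \<forall>k<d n. 0 \<le> r n k \<and> r n k \<le> \<rho> n) sequentially"
      using r by eventually_elim simp
    show "filterlim (\<lambda>n. \<Sum>k<d n. r n k) at_top sequentially"
      using filterlim_cong[OF refl refl sum_r] A by simp
    show "(\<lambda>n. (real (x n) - ?M n) / sqrt (\<Sum>k<d n. r n k)) \<longlonglongrightarrow> 0"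
      by (rule Lim_transform_eventually[OF mean]) (use sum_r in \<open>eventually_elim, simp\<close>)
  qed
  then have lim_a: "(\<lambda>n. sqrt (A n) * (a n * (1 + w n) ^ x n / G n)) \<longlonglongrightarrow> 1 / sqrt (2 * pi)"
    by (rule Lim_transform_eventually) (use sum_r in \<open>eventually_elim, simp\<close>)
  have "(\<lambda>n. sqrt (\<Sum>k<e n. s n k) * (b n * (1 + w n) ^ x n / H n)) \<longlonglongrightarrow> 1 / sqrt (2 * pi)"
    unfolding b_def H_def
  proof (rule tilted_llt[OF _ \<rho> w])
    show "eventually (\<lambda>n. \<forall>k<e n. 0 \<le> s n k \<and> s n k \<le> \<rho> n) sequentially"
      using s by eventually_elim simp
    show "filterlim (\<lambda>n. \<Sum>k<e n. s n k) at_top sequentially"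
      using filterlim_cong[OF refl refl sum_s] A by simp
    show "(\<lambda>n. (real (x n) - (\<Sum>k<e n. s n k * (1 + w n) / (1 + s n k * w n))) / sqrt (\<Sum>k<e n. s n k)) \<longlonglongrightarrow> 0"
      by (rule tendsto_eventually) (use x in \<open>eventually_elim, simp\<close>)
  qed
  then have lim_b: "(\<lambda>n. sqrt (A n) * (b n * (1 + w n) ^ x n / H n)) \<longlonglongrightarrow> 1 / sqrt (2 * pi)"
    by (rule Lim_transform_eventually) (use sum_s in \<open>eventually_elim, simp\<close>)
  have "(\<lambda>n. sqrt (A n) * (a n * (1 + w n) ^ x n / G n) / (sqrt (A n) * (b n * (1 + w n) ^ x n / H n)) * (G n / H n))
      \<longlonglongrightarrow> (1 / sqrt (2 * pi)) / (1 / sqrt (2 * pi)) * 1"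
    by (intro tendsto_intros lim_a lim_b GH_lim) simp
  then have "(\<lambda>n. sqrt (A n) * (a n * (1 + w n) ^ x n / G n) / (sqrt (A n) * (b n * (1 + w n) ^ x n / H n)) * (G n / H n)) \<longlonglongrightarrow> 1"
    by simp
  moreover have "eventually (\<lambda>n. sqrt (A n) * (a n * (1 + w n) ^ x n / G n) / (sqrt (A n) * (b n * (1 + w n) ^ x n / H n)) * (G n / H n) = a n / b n) sequentially"
    using ev GH
  proof eventually_elim
    case (elim n)
    then have "1 + w n \<noteq> 0" by (auto simp: abs_le_iff)
    then show ?case
      using elim by simp
  qed
  ultimately show ?thesis
    unfolding a_def b_def by (rule Lim_transform_eventually)
qed

section \<open>The effect of rounding the number of binomial trials\<close>

text \<open>The threshold 6 is what makes n/3 - 1 >= n/6.\<close>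

lemma NN_bounds:
  assumes "n \<ge> 6"
  shows "real n / 6 \<le> real (NN n)" "real (NN n) \<le> Ntil n" "Ntil n - 1 \<le> real (NN n)" "real n / 3 \<le> Ntil n"
proof -
  have "0 < 3 * real n - 2"
    using assms by simp
  then show nt: "real n / 3 \<le> Ntil n"
    unfolding Ntil_def by (simp add: pos_le_divide_eq power2_eq_square algebra_simps)
  then have "0 \<le> Ntil n"
    by (rule order_trans[rotated]) simp
  then have eq: "real (NN n) = of_int \<lfloor>Ntil n\<rfloor>"
    by (simp add: NN_def)
  show "real (NN n) \<le> Ntil n" "Ntil n - 1 \<le> real (NN n)"
    unfolding eq by linarith+
  then show "real n / 6 \<le> real (NN n)"
    using nt assms by linarith
qed

text \<open>As 3 n - 2 = n^2 / \<open>Ntil n\<close>, rounding changes the quotient by at most n^2 /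
  ((n/6) (n/3)) = 18.\<close>

lemma NN_variance_gap:
  assumes "n \<ge> 6"
  shows "\<bar>(3 * real n - 2) - (real n)\<^sup>2 / real (NN n)\<bar> \<le> 18"
proof -
  note b = NN_bounds[OF assms]
  have pos: "0 < real (NN n)" "0 < Ntil n"
    using b(1,4) assms by linarith+
  have inv: "3 * real n - 2 = (real n)\<^sup>2 / Ntil n"
    using assms by (simp add: Ntil_def)
  have "(3 * real n - 2) - (real n)\<^sup>2 / real (NN n) = - ((real n)\<^sup>2 * (Ntil n - real (NN n)) / (real (NN n) * Ntil n))"
    unfolding inv using pos by (simp add: field_simps)
  also have "\<bar>\<dots>\<bar> = (real n)\<^sup>2 * (Ntil n - real (NN n)) / (real (NN n) * Ntil n)"
    using pos b by simp
  also have "\<dots> \<le> (real n)\<^sup>2 * 1 / ((real n / 6) * (real n / 3))"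
    using pos b assms by (intro frac_le mult_left_mono mult_mono) auto
  also have "\<dots> = 18"
    using assms by (simp add: power2_eq_square)
  finally show ?thesis .
qed

section \<open>Asymptotic comparison of S with the binomial distribution\<close>

theorem theorem4:
  fixes p :: "nat \<Rightarrow> real" and x :: "nat \<Rightarrow> nat"
  assumes "\<And>n. 0 < p n \<and> p n < 1"
    and "p \<longlonglongrightarrow> 0"
    and "filterlim (\<lambda>n. real n * p n) at_top sequentially"
    and "(\<lambda>n. \<bar>real (x n) - real n * alpha (p n)\<bar>)
           \<in> o(\<lambda>n. min (real n * p n) (real n powr (2/3)))"
  shows "(\<lambda>n. probS n (p n) (x n) / BI (NN n) (ptil n (p n)) (x n)) \<longlonglongrightarrow> 1"
proof -
  define \<alpha> where "\<alpha> = (\<lambda>n. alpha (p n))"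
  define A where "A = (\<lambda>n. real n * \<alpha> n)"
  define q where "q = (\<lambda>n. ptil n (p n))"
  define \<Delta> where "\<Delta> = (\<lambda>n. real (x n) - A n)"
  \<comment> \<open>The cube root of n turns the powers n and n^(2/3) into c^3 and c^2.\<close>
  define c where "c = (\<lambda>n. real n powr (1 / 3))"
  \<comment> \<open>the tilt \<open>1 + w\<close> that moves the mean of the binomial distribution to exactly \<open>x\<close>\<close>
  define w where "w = (\<lambda>n. \<Delta> n / A n / (1 - (1 + \<Delta> n / A n) * q n))"
  have p: "0 < p n" "p n < 1" for n
    using assms(1) by auto
  have \<alpha>_pos: "0 < \<alpha> n" for n
    using p[of n] by (simp add: \<alpha>_def alpha_def)
  have \<alpha>_le: "\<alpha> n \<le> 1" for n
    using p[of n] by (simp add: \<alpha>_def alpha_def mult_le_one)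
  have \<alpha>0: "\<alpha> \<longlonglongrightarrow> 0"
    using tendsto_mult[OF assms(2) tendsto_diff[OF tendsto_const[of 1] assms(2)]]
    by (simp add: \<alpha>_def alpha_def)
  have A: "filterlim A at_top sequentially"
  proof -
    have "filterlim (\<lambda>n. (1 - p n) * (real n * p n)) at_top sequentially"
      by (rule filterlim_tendsto_pos_mult_at_top[OF tendsto_diff[OF tendsto_const[of 1] assms(2)] _ assms(3)]) simp
    then show ?thesis
      by (simp add: A_def \<alpha>_def alpha_def mult_ac)
  qed
  have c_pow: "c n ^ 3 = real n" "c n ^ 2 = real n powr (2 / 3)" for n
    by (cases "n = 0"; simp add: c_def powr_powr flip: powr_realpow)+
  have small: "(\<lambda>n. \<Delta> n) \<in> o(\<lambda>n. min (real n * p n) (real n powr (2/3)))"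
    using assms(4) by (simp add: \<Delta>_def A_def \<alpha>_def)
  \<comment> \<open>The two terms of the minimum are used separately: n^(2/3) here, and n p for
    \<open>\<Delta>_A\<close>.\<close>
  have \<Delta>_c: "(\<lambda>n. \<Delta> n / c n ^ 2) \<longlonglongrightarrow> 0"
  proof -
    have "(\<lambda>n. min (real n * p n) (real n powr (2/3))) \<in> O(\<lambda>n. real n powr (2/3))"
      using p by (intro bigoI[of _ 1] always_eventually) (auto simp: less_imp_le)
    from landau_o.small_big_trans[OF small this] show ?thesis
      unfolding c_pow by (rule smalloD_tendsto)
  qed
  have \<Delta>_A: "(\<lambda>n. \<Delta> n / A n) \<longlonglongrightarrow> 0"
  proof -
    have "(\<lambda>n. min (real n * p n) (real n powr (2/3))) \<in> O(\<lambda>n. real n * p n)"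
      using p by (intro bigoI[of _ 1] always_eventually) (auto simp: less_imp_le)
    from smalloD_tendsto[OF landau_o.small_big_trans[OF small this]]
    have "(\<lambda>n. \<Delta> n / (real n * p n) / (1 - p n)) \<longlonglongrightarrow> 0 / (1 - 0)"
      by (intro tendsto_intros assms(2)) auto
    then show ?thesis
      by (simp add: A_def \<alpha>_def alpha_def mult_ac)
  qed
  \<comment> \<open>From N >= n/6. As the weights are at most 4, the bound 6 \<alpha> serves both
    families as \<open>\<rho>\<close>.\<close>
  have q_bounds: "0 \<le> q n \<and> q n \<le> 6 * \<alpha> n" if "n \<ge> 6" for n
  proof -
    have N: "real n / 6 \<le> real (NN n)"
      using NN_bounds(1)[OF that] .
    then have "0 < real (NN n)"
      using that by linarith
    moreover have "real n * \<alpha> n \<le> 6 * \<alpha> n * real (NN n)"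
      using mult_right_mono[OF N less_imp_le[OF \<alpha>_pos[of n]]] by (simp add: mult_ac)
    ultimately show ?thesis
      using \<alpha>_pos[of n] by (simp add: q_def ptil_def \<alpha>_def pos_divide_le_eq)
  qed
  have \<rho>0: "(\<lambda>n. 6 * \<alpha> n) \<longlonglongrightarrow> 0"
    using tendsto_mult_left[OF \<alpha>0, of 6] by simp
  have q0: "q \<longlonglongrightarrow> 0"
    by (rule Lim_null_comparison[OF _ \<rho>0])
       (use q_bounds in \<open>auto simp: eventually_sequentially intro!: exI[of _ 6]\<close>)
  have den: "(\<lambda>n. 1 - (1 + \<Delta> n / A n) * q n) \<longlonglongrightarrow> 1"
  proof -
    have "(\<lambda>n. 1 - (1 + \<Delta> n / A n) * q n) \<longlonglongrightarrow> 1 - (1 + 0) * 0"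
      by (intro tendsto_intros \<Delta>_A q0)
    then show ?thesis by simp
  qed
  have w0: "w \<longlonglongrightarrow> 0"
    using tendsto_divide[OF \<Delta>_A den] by (simp add: w_def)
  have ev: "eventually (\<lambda>n. n \<ge> 6 \<and> 0 < A n \<and> 0 < 1 - (1 + \<Delta> n / A n) * q n \<and> \<bar>w n\<bar> < 1 / 2 \<and> 6 * \<alpha> n < 1 / 2) sequentially"
  proof (intro eventually_conj)
    show "eventually (\<lambda>n. 0 < A n) sequentially"
      using A by (auto simp: filterlim_at_top_dense)
    show "eventually (\<lambda>n. \<bar>w n\<bar> < 1 / 2) sequentially"
      using order_tendstoD(2)[OF tendsto_rabs_zero[OF w0], of "1 / 2"] by simp
    show "eventually (\<lambda>n. 0 < 1 - (1 + \<Delta> n / A n) * q n) sequentially"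
      using order_tendstoD(1)[OF den, of 0] by simp
    show "eventually (\<lambda>n. 6 * \<alpha> n < 1 / 2) sequentially"
      using order_tendstoD(2)[OF \<rho>0, of "1 / 2"] by simp
  qed (rule eventually_ge_at_top)
  \<comment> \<open>The single small parameter: up to a factor tending to 1 it is
    \<open>\<Delta>\<close> divided by n^(2/3), and both error conditions reduce to powers of
    it.\<close>
  define y where "y = (\<lambda>n. c n * \<alpha> n * w n)"
  have y0: "y \<longlonglongrightarrow> 0"
  proof -
    have "(\<lambda>n. \<Delta> n / c n ^ 2 / (1 - (1 + \<Delta> n / A n) * q n)) \<longlonglongrightarrow> 0 / 1"
      by (intro tendsto_divide \<Delta>_c den) simp
    moreover have "eventually (\<lambda>n. \<Delta> n / c n ^ 2 / (1 - (1 + \<Delta> n / A n) * q n) = y n) sequentially"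
      using ev
    proof eventually_elim
      case (elim n)
      then have c: "0 < c n"
        by (simp add: c_def)
      have "\<Delta> n / c n ^ 2 = c n * \<alpha> n * (\<Delta> n / A n)"
      proof -
        have "A n = c n ^ 3 * \<alpha> n"
          by (simp add: A_def c_pow)
        then show ?thesis
          using c \<alpha>_pos[of n] by (simp add: power2_eq_square power3_eq_cube)
      qed
      then show ?case
        by (simp only: y_def w_def times_divide_eq_right)
    qed
    ultimately show ?thesis
      using Lim_transform_eventually by fastforce
  qed
  have ratio: "(\<lambda>n. coeff (\<Prod>k<Suc n div 2. [:1 - \<alpha> n * fib_weight (Suc n) k, \<alpha> n * fib_weight (Suc n) k:]) (x n)
      / coeff (\<Prod>k<NN n. [:1 - q n, q n:]) (x n)) \<longlonglongrightarrow> 1"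
  proof (rule bernoulli_poly_coeff_ratio[OF _ _ \<rho>0 w0 A])
    show "eventually (\<lambda>n. (\<forall>k<Suc n div 2. 0 \<le> \<alpha> n * fib_weight (Suc n) k \<and> \<alpha> n * fib_weight (Suc n) k \<le> 6 * \<alpha> n)
        \<and> (\<Sum>k<Suc n div 2. \<alpha> n * fib_weight (Suc n) k) = A n) sequentially"
    proof (intro always_eventually allI conjI impI)
      fix n k
      show "0 \<le> \<alpha> n * fib_weight (Suc n) k"
        using \<alpha>_pos[of n] fib_weight_nonneg[of "Suc n" k] by simp
      have "\<alpha> n * fib_weight (Suc n) k \<le> \<alpha> n * 6"
        using \<alpha>_pos[of n] fib_weight_le[of "Suc n" k] by (intro mult_left_mono) auto
      then show "\<alpha> n * fib_weight (Suc n) k \<le> 6 * \<alpha> n"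
        by simp
      show "(\<Sum>k<Suc n div 2. \<alpha> n * fib_weight (Suc n) k) = A n"
        unfolding sum_distrib_left[symmetric] sum_fib_weight by (simp add: A_def)
    qed
    have Nq: "real (NN n) * q n = A n" if "n \<ge> 6" for n
      using NN_bounds(1)[OF that] that by (simp add: q_def ptil_def A_def \<alpha>_def)
    show "eventually (\<lambda>n. (\<forall>k<NN n. 0 \<le> q n \<and> q n \<le> 6 * \<alpha> n) \<and> (\<Sum>k<NN n. q n) = A n) sequentially"
      using ev by eventually_elim (use q_bounds Nq in auto)
    show "eventually (\<lambda>n. (\<Sum>k<NN n. q n * (1 + w n) / (1 + q n * w n)) = real (x n)) sequentially"
      using ev
    proof eventually_elim
      case (elim n)
      define D where "D = 1 - (1 + \<Delta> n / A n) * q n"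
      define e where "e = \<Delta> n / A n"
      have D: "D = 1 - (1 + e) * q n" "0 < D" and w: "w n = e / D"
        using elim by (simp_all add: D_def e_def w_def)
      have "0 \<le> q n" "q n \<le> 1 / 2"
        using q_bounds[of n] elim by auto
      then have "0 < 1 - q n" by simp
      \<comment> \<open>The choice of \<open>w\<close> solves q (1 + w) / (1 + q w) = q (1 + e), so
        the tilted binomial mean is A (1 + e) = x.\<close>
      have "1 + q n * w n = (1 - q n) / D" "1 + w n = (1 + e) * (1 - q n) / D"
        using D(2) unfolding w by (simp_all add: field_simps) (simp_all add: D(1) algebra_simps)
      then have "q n * (1 + w n) / (1 + q n * w n) = q n * (1 + e)"
        using D(2) \<open>0 < 1 - q n\<close> by simp
      then have "(\<Sum>k<NN n. q n * (1 + w n) / (1 + q n * w n)) = A n * (1 + e)"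
        using Nq[of n] elim by (simp flip: mult.assoc)
      also have "\<dots> = real (x n)"
        using elim by (simp add: e_def \<Delta>_def field_simps)
      finally show ?case .
    qed
    \<comment> \<open>The square sums are \<alpha>^2 (3 n - 2) and \<alpha>^2 n^2 / N; their gap is
      at most 18 \<alpha>^2, which tends to 0.\<close>
    show "(\<lambda>n. (\<Sum>k<Suc n div 2. (\<alpha> n * fib_weight (Suc n) k)\<^sup>2) - (\<Sum>k<NN n. (q n)\<^sup>2)) \<longlonglongrightarrow> 0"
    proof (rule Lim_null_comparison)
      show "eventually (\<lambda>n. norm ((\<Sum>k<Suc n div 2. (\<alpha> n * fib_weight (Suc n) k)\<^sup>2) - (\<Sum>k<NN n. (q n)\<^sup>2))
          \<le> 18 * (\<alpha> n)\<^sup>2) sequentially"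
        using ev
      proof eventually_elim
        case (elim n)
        have "(\<Sum>k<Suc n div 2. (\<alpha> n * fib_weight (Suc n) k)\<^sup>2) = (\<alpha> n)\<^sup>2 * (3 * real n - 2)"
          using elim by (simp add: power_mult_distrib sum_fib_weight_sq flip: sum_distrib_left)
        moreover have "(\<Sum>k<NN n. (q n)\<^sup>2) = (\<alpha> n)\<^sup>2 * ((real n)\<^sup>2 / real (NN n))"
          by (simp add: q_def ptil_def \<alpha>_def power2_eq_square)
        ultimately have "(\<Sum>k<Suc n div 2. (\<alpha> n * fib_weight (Suc n) k)\<^sup>2) - (\<Sum>k<NN n. (q n)\<^sup>2)
           = (\<alpha> n)\<^sup>2 * ((3 * real n - 2) - (real n)\<^sup>2 / real (NN n))"
          by (simp only: right_diff_distrib)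
        then show ?case
          using mult_left_mono[OF NN_variance_gap[of n], of "(\<alpha> n)\<^sup>2"] elim
          by (simp only: real_norm_def abs_mult abs_power2) (simp add: mult.commute)
      qed
      have "(\<lambda>n. 18 * (\<alpha> n)\<^sup>2) \<longlonglongrightarrow> 18 * 0\<^sup>2"
        by (intro tendsto_intros \<alpha>0)
      then show "(\<lambda>n. 18 * (\<alpha> n)\<^sup>2) \<longlonglongrightarrow> 0" by simp
    qed
    have eq: "\<bar>w n\<bar> ^ 3 * (6 * \<alpha> n)\<^sup>2 * A n = 36 * \<bar>y n\<bar> ^ 3" for n
    proof -
      have "0 \<le> c n" by (simp add: c_def)
      then have "\<bar>y n\<bar> = c n * \<alpha> n * \<bar>w n\<bar>"
        using \<alpha>_pos[of n] by (simp add: y_def abs_mult)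
      moreover have "A n = c n ^ 3 * \<alpha> n"
        by (simp add: A_def c_pow)
      ultimately show ?thesis
        by (simp add: power2_eq_square power3_eq_cube)
    qed
    have "(\<lambda>n. 36 * \<bar>y n\<bar> ^ 3) \<longlonglongrightarrow> 36 * \<bar>0\<bar> ^ 3"
      by (intro tendsto_intros y0)
    then show "(\<lambda>n. \<bar>w n\<bar> ^ 3 * (6 * \<alpha> n)\<^sup>2 * A n) \<longlonglongrightarrow> 0"
      unfolding eq by simp
    show "(\<lambda>n. (w n)\<^sup>2 * (6 * \<alpha> n)\<^sup>2 * sqrt (A n)) \<longlonglongrightarrow> 0"
    proof (rule Lim_null_comparison)
      show "eventually (\<lambda>n. norm ((w n)\<^sup>2 * (6 * \<alpha> n)\<^sup>2 * sqrt (A n)) \<le> 36 * (y n)\<^sup>2) sequentially"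
        using ev
      proof eventually_elim
        case (elim n)
        have c1: "1 \<le> c n"
          using elim by (simp add: c_def ge_one_powr_ge_zero)
        \<comment> \<open>Since A <= n = c^3 <= c^4, sqrt A is at most c^2, and the second error is
          at most 36 y^2.\<close>
        have "A n \<le> real n * 1"
          unfolding A_def using \<alpha>_le by (intro mult_left_mono) auto
        also have "\<dots> = c n ^ 3"
          by (simp add: c_pow)
        also have "\<dots> \<le> c n ^ 4"
          using c1 by (intro power_increasing) auto
        also have "\<dots> = (c n ^ 2) ^ 2"
          by simp
        finally have "sqrt (A n) \<le> c n ^ 2"
          by (intro real_le_lsqrt) auto
        then have "(w n)\<^sup>2 * (6 * \<alpha> n)\<^sup>2 * sqrt (A n) \<le> (w n)\<^sup>2 * (6 * \<alpha> n)\<^sup>2 * c n ^ 2"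
          by (intro mult_left_mono) auto
        also have "\<dots> = 36 * (y n)\<^sup>2"
          by (simp add: y_def power_mult_distrib)
        finally show ?case
          using elim by simp
      qed
      have "(\<lambda>n. 36 * (y n)\<^sup>2) \<longlonglongrightarrow> 36 * 0\<^sup>2"
        by (intro tendsto_intros y0)
      then show "(\<lambda>n. 36 * (y n)\<^sup>2) \<longlonglongrightarrow> 0" by simp
    qed
  qed
  have "probS n (p n) (x n) / BI (NN n) (ptil n (p n)) (x n)
     = coeff (\<Prod>k<Suc n div 2. [:1 - \<alpha> n * fib_weight (Suc n) k, \<alpha> n * fib_weight (Suc n) k:]) (x n)
      / coeff (\<Prod>k<NN n. [:1 - q n, q n:]) (x n)" for n
    unfolding BI_eq_coeff q_def \<alpha>_def using p[of n] by (subst probS_eq_coeff) auto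
  with ratio show ?thesis
    by simp
qed

end
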